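(* The full octonionic right spectrum of $h$ is obtained from any fixed slice computation by $G_2$-symmetry. More precisely, $$\operatorname{Spec}_{\mathrm{right}}(h)=\left\{\mu+Q\hat u\in\mathbb O:\ \hat u\in\operatorname{Im}\mathbb O,\ |\hat u|=1,\ (\mu,Q)\in\mathcal L\right\},$$ where $\mathcal L\subset\mathbb R^2$ is the union of the quartic locus $$\mu^4+6\mu^3+(2Q^2-15)\mu^2+(6Q^2-56)\mu+Q^4+Q^2=0$$ and the circle $$Q^2+\mu^2+4\mu=0.$$ Equivalently, the non-real right spectrum is obtained by rotating the non-real points ($Q\neq0$) of these two planar loci, viewed in $\mathbb R\oplus\mathbb R\hat u$ for one chosen unit imaginary $\hat u$, through the $G_2$-orbit of $\hat u$.
   Context: $\mathbb O$ is the octonion algebra. $V$ is an oriented Euclidean $7$-dimensional real vector space with a fixed isometric identification $V\cong\hat V:=\operatorname{Im}\mathbb O$, $v\mapsto\hat v$; only hatted vectors are multiplied in $\mathbb O$. $G_2=\operatorname{Aut}(\mathbb O)$. Let $W=\mathbb O\otimes_{\mathbb R}V$. Fix an orthonormal basis $e_1,\dots,e_7$ of $V$ with corresponding basis $\hat e_1,\dots,\hat e_7$ of $\hat V$; repeated indices are summed. The real-linear operator $h:W\to W$ (independent of the basis) is $h(\hat w)=\big((\hat e_i\hat e_j)\hat w_j\big)\otimes e_i$ for $\hat w=\hat w_j\otimes e_j$, $\hat w_j\in\mathbb O$. Right multiplication is $\hat w\lambda=R_\lambda(\hat w)$ with $R_\lambda(x\otimes v)=(x\lambda)\otimes v$.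 The right spectrum is $\operatorname{Spec}_{\mathrm{right}}(h)=\{\lambda\in\mathbb O:\exists\,\hat w\in W\setminus\{0\},\ h(\hat w)=\hat w\lambda\}=\{\lambda\in\mathbb O:\ker(h-R_\lambda)\ne0\}$. *)

theory Defs
  imports "HOL-Analysis.Analysis" "HOL-Library.Multiset"
begin

section \<open>The octonions\<close>

text \<open>
  The octonions are obtained from the complex numbers by two Cayley--Dickson doublings
  $(a,b)(c,d) = (ac - \bar d b,\; da + b\bar c)$, $\overline{(a,b)} = (\bar a, -b)$.
  As pairs they inherit the real vector space structure and the Euclidean inner product and norm
  from the product instances, and these are the standard ones on the octonions.
\<close>

type_synonym quaternion = "complex \<times> complex"
type_synonym octonion = "quaternion \<times> quaternion"

definition quat_cnj :: "quaternion \<Rightarrow> quaternion" where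
  "quat_cnj p = (cnj (fst p), - snd p)"

definition quat_mult :: "quaternion \<Rightarrow> quaternion \<Rightarrow> quaternion" where
  "quat_mult p q =
     (fst p * fst q - cnj (snd q) * snd p, snd q * fst p + snd p * cnj (fst q))"

definition oct_mult :: "octonion \<Rightarrow> octonion \<Rightarrow> octonion"  (infixl "\<star>" 70) where
  "x \<star> y =
     (quat_mult (fst x) (fst y) - quat_mult (quat_cnj (snd y)) (snd x),
      quat_mult (snd y) (fst x) + quat_mult (snd x) (quat_cnj (fst y)))"

definition oct_of_real :: "real \<Rightarrow> octonion" where
  "oct_of_real r = ((complex_of_real r, 0), (0, 0))"

definition oct_Re :: "octonion \<Rightarrow> real" where
  "oct_Re x = Re (fst (fst x))"

definition Im_Oct :: "octonion set" where
  "Im_Oct = {x. oct_Re x = 0}"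

definition unit_Im_Oct :: "octonion set" where
  "unit_Im_Oct = {u \<in> Im_Oct. norm u = 1}"

definition G2 :: "(octonion \<Rightarrow> octonion) set" where
  "G2 = {\<phi>. linear \<phi> \<and> bij \<phi> \<and> (\<forall>x y. \<phi> (x \<star> y) = \<phi> x \<star> \<phi> y)}"

definition G2_orbit :: "octonion \<Rightarrow> octonion set" where
  "G2_orbit x = {\<phi> x |\<phi>. \<phi> \<in> G2}"

lemma bilinear_oct_mult: "bilinear (\<star>)"
  unfolding bilinear_def
  by (auto intro!: linearI
      simp: oct_mult_def quat_mult_def quat_cnj_def algebra_simps prod_eq_iff scaleR_conv_of_real)

section \<open>The tensor product of two real vector spaces\<close>

text \<open>
  A multiset of pairs stands for the formal sum of the corresponding pure tensors;
  \<open>tensor_eq\<close> is the congruence generated by the bilinearity relations. Scalars need no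
  separate treatment in the formal sums, since they can be absorbed into the left factors.
\<close>

inductive tensor_eq ::
  "('a::real_vector \<times> 'b::real_vector) multiset \<Rightarrow> ('a \<times> 'b) multiset \<Rightarrow> bool" where
  refl: "tensor_eq A A"
| sym: "tensor_eq A B \<Longrightarrow> tensor_eq B A"
| trans: "tensor_eq A B \<Longrightarrow> tensor_eq B C \<Longrightarrow> tensor_eq A C"
| cong: "tensor_eq A B \<Longrightarrow> tensor_eq (A + C) (B + C)"
| zero: "tensor_eq {#(0, y)#} {#}"
| add_left: "tensor_eq {#(x + x', y)#} ({#(x, y)#} + {#(x', y)#})"
| add_right: "tensor_eq {#(x, y + y')#} ({#(x, y)#} + {#(x, y')#})"
| balanced: "tensor_eq {#(c *\<^sub>R x, y)#} {#(x, c *\<^sub>R y)#}"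

lemma tensor_eq_add:
  assumes "tensor_eq A B" "tensor_eq C D"
  shows "tensor_eq (A + C) (B + D)"
  using tensor_eq.cong[OF assms(1), of C] tensor_eq.cong[OF assms(2), of B]
  by (metis add.commute tensor_eq.trans)

quotient_type (overloaded) ('a, 'b) tensor =
  "('a::real_vector \<times> 'b::real_vector) multiset" / tensor_eq
  by (rule equivpI)
    (auto simp: reflp_def symp_def transp_def intro: tensor_eq.refl tensor_eq.sym tensor_eq.trans)

lemma tensor_eq_scale:
  assumes "tensor_eq A B"
  shows "tensor_eq (image_mset (map_prod (scaleR c) id) A) (image_mset (map_prod (scaleR c) id) B)"
  using assms
proof induction
  case (balanced d x y)
  then show ?case
    using tensor_eq.balanced[of d "c *\<^sub>R x" y] by (simp add: mult.commute)
next
  case (add_left x x' y)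
  then show ?case
    using tensor_eq.add_left[of "c *\<^sub>R x" "c *\<^sub>R x'" y]
    by (simp only: image_mset_union image_mset_single map_prod_simp scaleR_add_right id_apply)
next
  case (add_right x y y')
  then show ?case
    using tensor_eq.add_right[of "c *\<^sub>R x" y y']
    by (simp only: image_mset_union image_mset_single map_prod_simp id_apply)
qed (auto intro: tensor_eq.intros)

lemma tensor_eq_scale_add:
  "tensor_eq (image_mset (map_prod (scaleR (c + d)) id) A)
     (image_mset (map_prod (scaleR c) id) A + image_mset (map_prod (scaleR d) id) A)"
proof (induction A)
  case (add p A)
  obtain x y where p: "p = (x, y)" by (cases p)
  have "tensor_eq {#((c + d) *\<^sub>R x, y)#} ({#(c *\<^sub>R x, y)#} + {#(d *\<^sub>R x, y)#})"
    unfolding scaleR_add_left by (rule tensor_eq.add_left)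
  from tensor_eq_add[OF this add.IH] show ?case
    by (simp add: p add_mset_commute)
qed (simp add: tensor_eq.refl)

lemma tensor_eq_scale_zero: "tensor_eq (image_mset (map_prod (scaleR 0) id) A) {#}"
proof (induction A)
  case (add p A)
  then show ?case
    using tensor_eq_add[OF tensor_eq.zero[of "snd p"] add.IH] by (cases p) simp
qed (simp add: tensor_eq.refl)

instantiation tensor :: (real_vector, real_vector) real_vector
begin

lift_definition zero_tensor :: "('a, 'b) tensor" is "{#}" .

lift_definition plus_tensor :: "('a, 'b) tensor \<Rightarrow> ('a, 'b) tensor \<Rightarrow> ('a, 'b) tensor" is "(+)"
  by (rule tensor_eq_add)

lift_definition scaleR_tensor :: "real \<Rightarrow> ('a, 'b) tensor \<Rightarrow> ('a, 'b) tensor" is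
  "\<lambda>c. image_mset (map_prod (scaleR c) id)"
  by (rule tensor_eq_scale)

definition uminus_tensor :: "('a, 'b) tensor \<Rightarrow> ('a, 'b) tensor" where
  "uminus_tensor t = (- 1) *\<^sub>R t"

definition minus_tensor :: "('a, 'b) tensor \<Rightarrow> ('a, 'b) tensor \<Rightarrow> ('a, 'b) tensor" where
  "minus_tensor s t = s + - t"

instance
proof
  fix a b :: real and r s t :: "('a, 'b) tensor"
  show "r + s + t = r + (s + t)" by transfer (simp add: add.assoc tensor_eq.refl)
  show "s + t = t + s" by transfer (simp add: add.commute tensor_eq.refl)
  show "0 + t = t" by transfer (simp add: tensor_eq.refl)
  have scale_one: "1 *\<^sub>R t = t"
    by transfer (simp add: tensor_eq.refl map_prod_def case_prod_unfold)
  have scale_add: "(a + b) *\<^sub>R t = a *\<^sub>R t + b *\<^sub>R t" for a b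
    by transfer (rule tensor_eq_scale_add)
  have scale_zero: "0 *\<^sub>R t = 0"
    by transfer (rule tensor_eq_scale_zero)
  show "- t + t = 0"
    using scale_add[of "-1" 1] by (simp add: uminus_tensor_def scale_one scale_zero)
  show "s - t = s + - t" by (simp add: minus_tensor_def)
  show "a *\<^sub>R (s + t) = a *\<^sub>R s + a *\<^sub>R t" by transfer (simp add: tensor_eq.refl)
  show "(a + b) *\<^sub>R t = a *\<^sub>R t + b *\<^sub>R t" by (rule scale_add)
  show "a *\<^sub>R b *\<^sub>R t = (a * b) *\<^sub>R t"
    by transfer
      (simp add: tensor_eq.refl multiset.map_comp comp_def map_prod_def case_prod_unfold)
  show "1 *\<^sub>R t = t" by (rule scale_one)
qed

end

lift_definition pure_tensor :: "'a::real_vector \<Rightarrow> 'b::real_vector \<Rightarrow> ('a, 'b) tensor"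
  (infix "\<otimes>" 75) is "\<lambda>x y. {#(x, y)#}" .

lemma bilinear_pure_tensor: "bilinear (\<otimes>)"
proof -
  have left: "(x + x') \<otimes> y = x \<otimes> y + x' \<otimes> y" for x x' :: 'a and y :: 'b
    by transfer (rule tensor_eq.add_left)
  have right: "x \<otimes> (y + y') = x \<otimes> y + x \<otimes> y'" for x :: 'a and y y' :: 'b
    by transfer (rule tensor_eq.add_right)
  have scale: "(c *\<^sub>R x) \<otimes> y = c *\<^sub>R (x \<otimes> y)" for c and x :: 'a and y :: 'b
    by transfer (simp add: tensor_eq.refl)
  have "(c *\<^sub>R x) \<otimes> y = x \<otimes> (c *\<^sub>R y)" for c and x :: 'a and y :: 'b
    by transfer (rule tensor_eq.balanced)
  with left right scale show ?thesis
    unfolding bilinear_def by (auto intro!: linearI)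
qed

lemma tensor_induct [case_names zero add]:
  assumes "P 0" "\<And>x y t. P t \<Longrightarrow> P (x \<otimes> y + t)"
  shows "P t"
proof -
  have "P (abs_tensor A)" for A
  proof (induction A)
    case empty
    then show ?case using assms(1) by (simp add: zero_tensor_def)
  next
    case (add p A)
    have "abs_tensor (add_mset p A) = fst p \<otimes> snd p + abs_tensor A"
      by (simp add: pure_tensor.abs_eq plus_tensor.abs_eq)
    with add assms(2) show ?case by simp
  qed
  then show ?thesis
    by (metis Quotient_abs_rep Quotient_tensor)
qed

text \<open>
  The linear map induced by a bilinear one; the value \<open>0\<close> for maps that are not bilinear is a dummy.
\<close>

lift_definition tensor_lift ::
  "('a::real_vector \<Rightarrow> 'b::real_vector \<Rightarrow> 'c::real_vector) \<Rightarrow> ('a, 'b) tensor \<Rightarrow> 'c" is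
  "\<lambda>f A. if bilinear f then \<Sum>(x, y)\<in>#A. f x y else 0"
proof -
  fix f :: "'a \<Rightarrow> 'b \<Rightarrow> 'c" and A B :: "('a \<times> 'b) multiset"
  assume "tensor_eq A B"
  then have "(\<Sum>(x, y)\<in>#A. f x y) = (\<Sum>(x, y)\<in>#B. f x y)" if "bilinear f"
    by induction
      (use that in \<open>auto simp: bilinear_lzero bilinear_ladd bilinear_radd bilinear_lmul bilinear_rmul\<close>)
  then show "(if bilinear f then \<Sum>(x, y)\<in>#A. f x y else 0) =
             (if bilinear f then \<Sum>(x, y)\<in>#B. f x y else 0)"
    by simp
qed

lemma tensor_lift_pure [simp]: "bilinear f \<Longrightarrow> tensor_lift f (x \<otimes> y) = f x y"
  by transfer simp

lemma linear_tensor_lift: "linear (tensor_lift f)"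
proof (rule linearI)
  show "tensor_lift f (s + t) = tensor_lift f s + tensor_lift f t" for s t
    by transfer simp
  show "tensor_lift f (c *\<^sub>R t) = c *\<^sub>R tensor_lift f t" for c t
  proof (induction t rule: tensor_induct)
    case zero
    then show ?case by transfer simp
  next
    case (add x y t)
    have "tensor_lift f (c *\<^sub>R (x \<otimes> y)) = c *\<^sub>R tensor_lift f (x \<otimes> y)"
      by transfer (simp add: bilinear_lmul)
    moreover have "tensor_lift f (s + t) = tensor_lift f s + tensor_lift f t" for s t
      by transfer simp
    ultimately show ?case using add by (simp add: scaleR_add_right)
  qed
qed

lemma tensor_universal_property:
  assumes "bilinear f"
  shows "\<exists>!g. linear g \<and> (\<forall>x y. g (x \<otimes> y) = f x y)"
proof (rule ex1I[of _ "tensor_lift f"])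
  show "linear (tensor_lift f) \<and> (\<forall>x y. tensor_lift f (x \<otimes> y) = f x y)"
    using assms by (simp add: linear_tensor_lift)
next
  fix g assume g: "linear g \<and> (\<forall>x y. g (x \<otimes> y) = f x y)"
  show "g = tensor_lift f"
  proof
    fix t show "g t = tensor_lift f t"
      by (induction t rule: tensor_induct)
        (use g assms in \<open>simp_all add: linear_0 linear_add linear_tensor_lift\<close>)
  qed
qed

section \<open>The operators on the octonionic space and the right spectrum\<close>

definition isometric_identification :: "('v::euclidean_space \<Rightarrow> octonion) \<Rightarrow> bool" where
  "isometric_identification hat \<longleftrightarrow>
     linear hat \<and> (\<forall>v. norm (hat v) = norm v) \<and> range hat = Im_Oct"

definition orthonormal_basis :: "(7 \<Rightarrow> 'v::euclidean_space) \<Rightarrow> bool" where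
  "orthonormal_basis e \<longleftrightarrow>
     (\<forall>i j. e i \<bullet> e j = (if i = j then 1 else 0)) \<and> span (range e) = UNIV"

text \<open>
  \<open>tcoeff v\<close> sends $x \otimes u$ to $\langle v, u\rangle x$, so for an orthonormal basis $e$ the
  coefficient $w_j$ of $w = \sum_j w_j \otimes e_j$ is \<open>tcoeff (e j) w\<close>.
\<close>

definition tcoeff :: "'v::euclidean_space \<Rightarrow> (octonion, 'v) tensor \<Rightarrow> octonion" where
  "tcoeff v = tensor_lift (\<lambda>x u. (v \<bullet> u) *\<^sub>R x)"

definition h_op ::
  "('v::euclidean_space \<Rightarrow> octonion) \<Rightarrow> (7 \<Rightarrow> 'v) \<Rightarrow> (octonion, 'v) tensor \<Rightarrow> (octonion, 'v) tensor"
  where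
  "h_op hat e w = (\<Sum>i\<in>UNIV. (\<Sum>j\<in>UNIV. (hat (e i) \<star> hat (e j)) \<star> tcoeff (e j) w) \<otimes> e i)"

definition R_op :: "octonion \<Rightarrow> (octonion, 'v::euclidean_space) tensor \<Rightarrow> (octonion, 'v) tensor" where
  "R_op l = tensor_lift (\<lambda>x v. (x \<star> l) \<otimes> v)"

definition right_spectrum ::
  "((octonion, 'v::euclidean_space) tensor \<Rightarrow> (octonion, 'v) tensor) \<Rightarrow> octonion set" where
  "right_spectrum T = {l. \<exists>w. w \<noteq> 0 \<and> T w = R_op l w}"

lemma bilinear_coeff: "bilinear (\<lambda>x u. (v \<bullet> u) *\<^sub>R (x :: octonion))"
  unfolding bilinear_def
  by (auto intro!: linearI simp: inner_add_right scaleR_add_left scaleR_add_right)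

lemma tcoeff_pure: "tcoeff v (x \<otimes> u) = (v \<bullet> u) *\<^sub>R x"
  by (simp add: tcoeff_def bilinear_coeff)

lemma tcoeff_basis:
  assumes "orthonormal_basis e"
  shows "tcoeff (e k) (\<Sum>j\<in>UNIV. w j \<otimes> e j) = w k"
proof -
  have "tcoeff (e k) (\<Sum>j\<in>UNIV. w j \<otimes> e j) = (\<Sum>j\<in>UNIV. (e k \<bullet> e j) *\<^sub>R w j)"
  proof -
    have "linear (tcoeff (e k))"
      unfolding tcoeff_def by (rule linear_tensor_lift)
    then show ?thesis by (simp add: linear_sum tcoeff_pure)
  qed
  also have "\<dots> = (\<Sum>j\<in>UNIV. if k = j then w j else 0)"
    using assms by (intro sum.cong) (auto simp: orthonormal_basis_def)
  finally show ?thesis by simp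
qed

lemma tensor_basis_expansion:
  fixes w :: "(octonion, 'v::euclidean_space) tensor"
  assumes "orthonormal_basis e"
  shows "w = (\<Sum>j\<in>UNIV. tcoeff (e j) w \<otimes> e j)"
proof (induction w rule: tensor_induct)
  case zero
  have "tcoeff v 0 = 0" for v :: 'v
    unfolding tcoeff_def by (rule linear_0[OF linear_tensor_lift])
  then show ?case by (simp add: bilinear_lzero[OF bilinear_pure_tensor])
next
  case (add x y t)
  have y: "y = (\<Sum>j\<in>UNIV. (e j \<bullet> y) *\<^sub>R e j)"
  proof -
    have "y \<in> span (range e)" using assms by (simp add: orthonormal_basis_def)
    then show ?thesis
    proof (induction rule: span_induct_alt)
      case (step c b z)
      then obtain k where k: "b = e k" by auto
      have "(\<Sum>j\<in>UNIV. (e j \<bullet> e k) *\<^sub>R e j) = (\<Sum>j\<in>UNIV. if j = k then e j else 0)"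
        using assms by (intro sum.cong) (auto simp: orthonormal_basis_def)
      then have "(\<Sum>j\<in>UNIV. (e j \<bullet> e k) *\<^sub>R e j) = e k" by simp
      then have "(\<Sum>j\<in>UNIV. (e j \<bullet> (c *\<^sub>R b + z)) *\<^sub>R e j) = c *\<^sub>R b + (\<Sum>j\<in>UNIV. (e j \<bullet> z) *\<^sub>R e j)"
        by (simp add: k inner_add_right scaleR_add_left sum.distrib
            flip: scaleR_scaleR scaleR_right.sum)
      with step show ?case by simp
    qed simp
  qed
  have "x \<otimes> y = (\<Sum>j\<in>UNIV. x \<otimes> ((e j \<bullet> y) *\<^sub>R e j))"
  proof -
    have "linear ((\<otimes>) x :: 'v \<Rightarrow> (octonion, 'v) tensor)"
      using bilinear_pure_tensor[where 'a = octonion and 'b = 'v] unfolding bilinear_def by blast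
    from linear_sum[OF this, of "\<lambda>j. (e j \<bullet> y) *\<^sub>R e j" UNIV] y show ?thesis by simp
  qed
  also have "\<dots> = (\<Sum>j\<in>UNIV. tcoeff (e j) (x \<otimes> y) \<otimes> e j)"
    by (simp add: tcoeff_pure bilinear_lmul[OF bilinear_pure_tensor]
        bilinear_rmul[OF bilinear_pure_tensor])
  finally have xy: "x \<otimes> y = (\<Sum>j\<in>UNIV. tcoeff (e j) (x \<otimes> y) \<otimes> e j)" .
  have "(\<Sum>j\<in>UNIV. tcoeff (e j) (x \<otimes> y + t) \<otimes> e j) =
        (\<Sum>j\<in>UNIV. tcoeff (e j) (x \<otimes> y) \<otimes> e j) + (\<Sum>j\<in>UNIV. tcoeff (e j) t \<otimes> e j)"
    by (simp add: tcoeff_def linear_add[OF linear_tensor_lift]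
        bilinear_ladd[OF bilinear_pure_tensor] sum.distrib)
  with xy add show ?case by simp
qed

lemma h_op_basis:
  assumes "orthonormal_basis e"
  shows "h_op hat e (\<Sum>j\<in>UNIV. w j \<otimes> e j) =
         (\<Sum>i\<in>UNIV. (\<Sum>j\<in>UNIV. (hat (e i) \<star> hat (e j)) \<star> w j) \<otimes> e i)"
  using assms by (simp add: h_op_def tcoeff_basis)

lemma R_op_pure: "R_op l (x \<otimes> v) = (x \<star> l) \<otimes> v"
proof -
  have "bilinear (\<lambda>x (v :: 'a). (x \<star> l) \<otimes> v)"
    unfolding bilinear_def
  proof (intro conjI allI)
    have pure: "bilinear ((\<otimes>) :: octonion \<Rightarrow> 'a \<Rightarrow> _)" by (rule bilinear_pure_tensor)
    show "linear (\<lambda>v :: 'a. (x \<star> l) \<otimes> v)" for x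
      using pure unfolding bilinear_def by blast
    show "linear (\<lambda>x. (x \<star> l) \<otimes> v)" for v :: 'a
      by (rule linearI)
        (simp_all add: bilinear_ladd[OF bilinear_oct_mult] bilinear_lmul[OF bilinear_oct_mult]
          bilinear_ladd[OF pure] bilinear_lmul[OF pure])
  qed
  then show ?thesis by (simp add: R_op_def)
qed

section \<open>The planar locus and the slices\<close>

definition spectral_locus :: "(real \<times> real) set" where
  "spectral_locus =
     {(\<mu>, Q). \<mu>^4 + 6 * \<mu>^3 + (2 * Q^2 - 15) * \<mu>^2 + (6 * Q^2 - 56) * \<mu> + Q^4 + Q^2 = 0} \<union>
     {(\<mu>, Q). Q^2 + \<mu>^2 + 4 * \<mu> = 0}"

definition slice :: "octonion \<Rightarrow> octonion set" where
  "slice u = {oct_of_real a + b *\<^sub>R u |a b. True}"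

end

theory Submission
  imports Defs
begin

text \<open>
  Over an orthonormal basis a tensor $w = \sum_j w_j \otimes e_j$ is the same thing as the real-linear map
  $f : \mathrm{Im}\,\mathbb{O} \to \mathbb{O}$ with $f(\hat e_j) = w_j$, and $h$ becomes the contraction
  $(hf)(v) = \sum_b (v b) f(b)$ over any orthonormal basis of $\mathrm{Im}\,\mathbb{O}$
  (\<open>right_spectrum_eq_eigenmap\<close>). Automorphisms of the octonions are isometries of $\mathrm{Im}\,\mathbb{O}$, so
  they carry an eigenmap for $\lambda$ to one for $\varphi(\lambda)$ (\<open>eigenmap_G2\<close>), and they act transitively on
  the unit sphere of $\mathrm{Im}\,\mathbb{O}$ (\<open>G2_transitive\<close>). Every octonion has the form $\mu + Q u$ with
  $u$ unit imaginary, so whether it lies in the spectrum depends on $(\mu, Q)$ alone and can be decided for one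
  chosen $u = i$. All parts of the theorem are formal consequences of this and of the slice computation.

  For $\lambda = z = \mu + iQ$ one decomposes under $SU(3)$, the stabiliser of $i$:
  $\mathbb{O} = \mathbb{C} \oplus \mathbb{C}^3$ and $\mathrm{Im}\,\mathbb{O} = i\mathbb{R} \oplus \mathbb{C}^3$, so that $f$ consists of a
  scalar $a$, vectors $p, A, B$ and matrices $M, N$. The equation $h f = f \lambda$ splits into small blocks
  (\<open>h_map_slice_map\<close>), whose solvability is as follows.

    \<^item> The trace-free part of $M$ pairs each entry with the conjugate of its transpose and has a nonzero solution exactly when
      $|z + 2| = 2$, which is the circle.
    \<^item> The block of the scalar $a$ and the trace of $M$ has a nonzero solution exactly when
      $|(z + 4)(z - 1)| = 4\,|z + 1|$, which is the quartic.
    \<^item> The symmetric part of $N$ is annihilated by $h$, so it contributes only $z = 0$, a point of the circle.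
    \<^item> The vectors $p$, $A$, $B$ and the antisymmetric part of $N$ form a complex-linear block after conjugating some of
      them. Its determinant is a complex polynomial in $z$ and $\bar z$, which turns out to vanish only at real
      points, all of them on the two curves (\<open>vector_determinant_zero\<close>).

  Hence the spectrum on the slice is the union of the circle and the quartic and nothing else.
\<close>

section \<open>Tensors as linear maps on the imaginary octonions\<close>

text \<open>
  Contracting a bilinear map over an orthonormal basis is a trace, hence independent of the basis.
  This is used twice: to replace \<open>hat \<circ> e\<close> by the standard units of \<open>Im_Oct\<close>, and to
  move the standard units by an element of \<open>G2\<close>.
\<close>

lemma bilinear_sum_orthonormal_bases:
  fixes g :: "'a::euclidean_space \<Rightarrow> 'a \<Rightarrow> 'b::real_vector"
  assumes g: "bilinear g"
    and B: "finite B" "pairwise orthogonal B" "\<And>b. b \<in> B \<Longrightarrow> norm b = 1"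
    and C: "finite C" "pairwise orthogonal C" "\<And>c. c \<in> C \<Longrightarrow> norm c = 1"
    and "span B = span C"
  shows "(\<Sum>b\<in>B. g b b) = (\<Sum>c\<in>C. g c c)"
proof -
  have expand_C: "(\<Sum>c\<in>C. (b \<bullet> c) *\<^sub>R c) = b" if "b \<in> B" for b
    using that assms by (intro orthonormal_basis_expand) (auto intro: span_base)
  have expand_B: "(\<Sum>b\<in>B. (c \<bullet> b) *\<^sub>R b) = c" if "c \<in> C" for c
    using that assms by (intro orthonormal_basis_expand) (auto intro: span_base)
  have right: "g b (\<Sum>c\<in>C. k c *\<^sub>R c) = (\<Sum>c\<in>C. k c *\<^sub>R g b c)" for b k
    using g by (simp add: bilinear_def linear_sum linear_cmul)
  have left: "g (\<Sum>b\<in>B. k b *\<^sub>R b) c = (\<Sum>b\<in>B. k b *\<^sub>R g b c)" for c k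
    using g linear_sum[of "\<lambda>x. g x c" "\<lambda>b. k b *\<^sub>R b" B] linear_cmul[of "\<lambda>x. g x c"]
    by (simp add: bilinear_def)
  have "(\<Sum>b\<in>B. g b b) = (\<Sum>b\<in>B. \<Sum>c\<in>C. (b \<bullet> c) *\<^sub>R g b c)"
    by (simp add: expand_C flip: right)
  also have "\<dots> = (\<Sum>c\<in>C. \<Sum>b\<in>B. (c \<bullet> b) *\<^sub>R g b c)"
    by (subst sum.swap) (simp add: inner_commute)
  also have "\<dots> = (\<Sum>c\<in>C. g c c)"
    by (simp add: expand_B flip: left)
  finally show ?thesis .
qed

definition Im_units :: "octonion set" where
  "Im_units = {((\<i>, 0), (0, 0)), ((0, 1), (0, 0)), ((0, \<i>), (0, 0)), ((0, 0), (1, 0)),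
     ((0, 0), (\<i>, 0)), ((0, 0), (0, 1)), ((0, 0), (0, \<i>))}"

text \<open>
  The operator \<open>h\<close> after the identification of $\mathbb{O} \otimes V$ with linear maps: the tensor
  $\sum_j w_j \otimes e_j$ becomes the map $f$ with $f(\hat e_j) = w_j$, and the $i$-th coefficient of
  its image under $h$ becomes the value at $v = \hat e_i$.
\<close>

definition h_map :: "(octonion \<Rightarrow> octonion) \<Rightarrow> octonion \<Rightarrow> octonion" where
  "h_map f v = (\<Sum>b\<in>Im_units. (v \<star> b) \<star> f b)"

text \<open>
  Only the restriction of \<open>f\<close> to \<open>Im_Oct\<close> represents a tensor; the value of \<open>f\<close> at the real
  unit is arbitrary, which is why the equation and the non-vanishing are required on \<open>Im_Oct\<close> alone.
\<close>

definition eigenmap :: "octonion \<Rightarrow> (octonion \<Rightarrow> octonion) \<Rightarrow> bool" where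
  "eigenmap l f \<longleftrightarrow> linear f \<and> (\<exists>v\<in>Im_Oct. f v \<noteq> 0) \<and> (\<forall>v\<in>Im_Oct. h_map f v = f v \<star> l)"

lemma linear_mult_right: "linear (\<lambda>x. x \<star> y)"
  using bilinear_oct_mult unfolding bilinear_def by blast

lemma linear_mult_left: "linear (\<lambda>y. x \<star> y)"
  using bilinear_oct_mult unfolding bilinear_def by blast

lemma finite_Im_units: "finite Im_units"
  by (simp add: Im_units_def)

lemma sum_Im_units:
  "(\<Sum>b\<in>Im_units. g b) = g ((\<i>, 0), (0, 0)) + g ((0, 1), (0, 0)) + g ((0, \<i>), (0, 0)) +
     g ((0, 0), (1, 0)) + g ((0, 0), (\<i>, 0)) + g ((0, 0), (0, 1)) + g ((0, 0), (0, \<i>))"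
  for g :: "octonion \<Rightarrow> 'a::comm_monoid_add"
  by (simp add: Im_units_def complex_eq_iff add.assoc)

lemma subspace_Im_Oct: "subspace Im_Oct"
  by (auto simp: subspace_def Im_Oct_def oct_Re_def)

lemma orthogonal_Im_units: "pairwise orthogonal Im_units"
  by (simp add: pairwise_def orthogonal_def Im_units_def inner_complex_def)

lemma norm_Im_units: "b \<in> Im_units \<Longrightarrow> norm b = 1"
  by (auto simp: Im_units_def norm_Pair)

lemma Im_Oct_expand:
  assumes "v \<in> Im_Oct"
  shows "(\<Sum>b\<in>Im_units. (v \<bullet> b) *\<^sub>R b) = v"
  using assms unfolding sum_Im_units
  by (simp add: Im_Oct_def oct_Re_def prod_eq_iff complex_eq_iff inner_prod_def inner_complex_def)

lemma span_Im_units: "span Im_units = Im_Oct"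
proof
  show "span Im_units \<subseteq> Im_Oct"
    by (rule span_minimal[OF _ subspace_Im_Oct]) (auto simp: Im_units_def Im_Oct_def oct_Re_def)
  show "Im_Oct \<subseteq> span Im_units"
  proof
    fix v assume "v \<in> Im_Oct"
    have "(\<Sum>b\<in>Im_units. (v \<bullet> b) *\<^sub>R b) \<in> span Im_units"
      by (intro span_sum span_scale span_base)
    with \<open>v \<in> Im_Oct\<close> show "v \<in> span Im_units"
      by (simp add: Im_Oct_expand)
  qed
qed

lemma bilinear_h_map_summand:
  assumes "linear f"
  shows "bilinear (\<lambda>b c. (v \<star> b) \<star> f c)"
  unfolding bilinear_def
  using linear_compose[OF assms linear_mult_left]
    linear_compose[OF linear_mult_left linear_mult_right]
  by (auto simp: o_def)

lemma h_map_orthonormal: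
  assumes "linear f" "finite C" "pairwise orthogonal C" "\<And>c. c \<in> C \<Longrightarrow> norm c = 1"
    "span C = Im_Oct"
  shows "h_map f v = (\<Sum>c\<in>C. (v \<star> c) \<star> f c)"
  unfolding h_map_def
  by (rule bilinear_sum_orthonormal_bases[OF bilinear_h_map_summand])
    (use assms span_Im_units finite_Im_units orthogonal_Im_units norm_Im_units in auto)

lemma linear_h_map: "linear (h_map f)"
proof -
  have "linear (\<lambda>v. (v \<star> b) \<star> f b)" for b
    using linear_compose[OF linear_mult_right linear_mult_right] by (simp add: o_def)
  then show ?thesis
    unfolding h_map_def[abs_def] by (intro linear_compose_sum) auto
qed

text \<open>
  Coefficients in the basis \<open>e\<close> translate tensors into linear maps and back. In particular the
  spectrum depends neither on the basis nor on the identification of $V$ with $\mathrm{Im}\,\mathbb{O}$.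
\<close>

lemma right_spectrum_eq_eigenmap:
  fixes hat :: "'v::euclidean_space \<Rightarrow> octonion" and e :: "7 \<Rightarrow> 'v"
  assumes hat: "isometric_identification hat" and e: "orthonormal_basis e"
  shows "right_spectrum (h_op hat e) = {l. \<exists>f. eigenmap l f}"
proof -
  define E where "E i = hat (e i)" for i
  have linear_hat: "linear hat" and norm_hat: "norm (hat v) = norm v" and range_hat: "range hat = Im_Oct" for v
    using hat by (auto simp: isometric_identification_def)
  have inner_hat: "hat v \<bullet> hat w = v \<bullet> w" for v w
  proof -
    have "norm (hat v + hat w) = norm (v + w)"
      using norm_hat[of "v + w"] linear_hat by (simp add: linear_add)
    then show ?thesis
      by (simp add: dot_norm norm_hat)
  qed
  have E: "E i \<bullet> E j = (if i = j then 1 else 0)" for i j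
    using e by (simp add: E_def inner_hat orthonormal_basis_def)
  have "inj E"
    using E by (intro injI) (metis zero_neq_one)
  have orthE: "pairwise orthogonal (range E)"
    using E by (auto simp: pairwise_def orthogonal_def)
  have normE: "norm c = 1" if "c \<in> range E" for c
    using E that by (auto simp: norm_eq_1)
  have spanE: "span (range E) = Im_Oct"
  proof -
    have "span (hat ` range e) = hat ` span (range e)"
      using linear_hat by (rule linear_span_image)
    then show ?thesis
      using e range_hat by (simp add: E_def[abs_def] image_image orthonormal_basis_def)
  qed
  have h_mapE: "h_map f v = (\<Sum>j\<in>UNIV. (v \<star> E j) \<star> f (E j))" if "linear f" for f v
    using h_map_orthonormal[OF that finite_imageI[OF finite] orthE normE spanE, of v] \<open>inj E\<close>
    by (simp add: sum.reindex)
  have linear_tcoeff: "linear (tcoeff (e i))" for i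
    unfolding tcoeff_def by (rule linear_tensor_lift)
  have R_op_basis: "R_op l (\<Sum>j\<in>UNIV. w j \<otimes> e j) = (\<Sum>j\<in>UNIV. (w j \<star> l) \<otimes> e j)" for l w
  proof -
    have "linear (R_op l :: (octonion, 'v) tensor \<Rightarrow> _)"
      unfolding R_op_def by (rule linear_tensor_lift)
    then show ?thesis by (simp add: linear_sum R_op_pure)
  qed
  have eigen_iff: "h_op hat e w = R_op l w \<longleftrightarrow>
      (\<forall>i. (\<Sum>j\<in>UNIV. (E i \<star> E j) \<star> tcoeff (e j) w) = tcoeff (e i) w \<star> l)" for l w
  proof -
    have h: "h_op hat e w = (\<Sum>i\<in>UNIV. (\<Sum>j\<in>UNIV. (E i \<star> E j) \<star> tcoeff (e j) w) \<otimes> e i)"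
      by (simp add: h_op_def E_def)
    have r: "R_op l w = (\<Sum>i\<in>UNIV. (tcoeff (e i) w \<star> l) \<otimes> e i)"
      by (subst tensor_basis_expansion[OF e, of w]) (rule R_op_basis)
    show ?thesis
    proof
      assume eq: "h_op hat e w = R_op l w"
      show "\<forall>i. (\<Sum>j\<in>UNIV. (E i \<star> E j) \<star> tcoeff (e j) w) = tcoeff (e i) w \<star> l"
      proof
        fix i
        have "tcoeff (e i) (h_op hat e w) = tcoeff (e i) (R_op l w)" by (simp only: eq)
        then show "(\<Sum>j\<in>UNIV. (E i \<star> E j) \<star> tcoeff (e j) w) = tcoeff (e i) w \<star> l"
          unfolding h r tcoeff_basis[OF e] .
      qed
    next
      assume "\<forall>i. (\<Sum>j\<in>UNIV. (E i \<star> E j) \<star> tcoeff (e j) w) = tcoeff (e i) w \<star> l"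
      then show "h_op hat e w = R_op l w"
        unfolding h r by simp
    qed
  qed
  show ?thesis
  proof (intro set_eqI iffI; clarsimp)
    fix l assume "l \<in> right_spectrum (h_op hat e)"
    then obtain w where "w \<noteq> 0" and w: "h_op hat e w = R_op l w"
      by (auto simp: right_spectrum_def)
    define f where "f x = (\<Sum>j\<in>UNIV. (x \<bullet> E j) *\<^sub>R tcoeff (e j) w)" for x
    have linear_f: "linear f"
      by (rule linearI)
        (simp_all add: f_def inner_add_left scaleR_add_left sum.distrib scaleR_sum_right)
    have f_E: "f (E i) = tcoeff (e i) w" for i
    proof -
      have "f (E i) = (\<Sum>j\<in>UNIV. if i = j then tcoeff (e j) w else 0)"
        unfolding f_def by (intro sum.cong) (auto simp: E)
      then show ?thesis by simp
    qed
    have "h_map f v = f v \<star> l" if "v \<in> Im_Oct" for v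
    proof -
      have "h_map f (E i) = f (E i) \<star> l" for i
        using w by (simp add: eigen_iff h_mapE[OF linear_f] f_E)
      then have "\<And>x. x \<in> range E \<Longrightarrow> h_map f x = ((\<lambda>y. y \<star> l) \<circ> f) x"
        by (metis comp_apply imageE)
      from linear_eq_on_span[OF linear_h_map linear_compose[OF linear_f linear_mult_right] this]
      show ?thesis using that by (simp add: spanE)
    qed
    moreover have "\<exists>v\<in>Im_Oct. f v \<noteq> 0"
    proof (rule ccontr)
      assume "\<not> ?thesis"
      then have "tcoeff (e i) w = 0" for i
        using span_base[of "E i" "range E"] f_E[of i] spanE by simp
      then have "w = 0"
        by (subst tensor_basis_expansion[OF e, of w]) (simp add: bilinear_lzero[OF bilinear_pure_tensor])
      with \<open>w \<noteq> 0\<close> show False by simp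
    qed
    ultimately show "\<exists>f. eigenmap l f"
      using linear_f by (auto simp: eigenmap_def)
  next
    fix l f assume f: "eigenmap l f"
    then have linear_f: "linear f" by (simp add: eigenmap_def)
    define w where "w = (\<Sum>j\<in>UNIV. f (E j) \<otimes> e j)"
    have tcoeff_w: "tcoeff (e i) w = f (E i)" for i
      unfolding w_def by (rule tcoeff_basis[OF e])
    have E_Im: "E i \<in> Im_Oct" for i
      using spanE span_base[of "E i" "range E"] by auto
    have "h_op hat e w = R_op l w"
      using f E_Im by (simp add: eigen_iff tcoeff_w eigenmap_def h_mapE[OF linear_f])
    moreover have "w \<noteq> 0"
    proof
      assume "w = 0"
      then have "f (E i) = 0" for i
        using tcoeff_w[of i] linear_0[OF linear_tcoeff] by simp
      then have "\<And>x. x \<in> range E \<Longrightarrow> f x = 0"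
        by (metis imageE)
      from linear_eq_0_on_span[OF linear_f this] have "f v = 0" if "v \<in> Im_Oct" for v
        using that by (simp add: spanE)
      with f show False by (auto simp: eigenmap_def)
    qed
    ultimately show "l \<in> right_spectrum (h_op hat e)"
      by (auto simp: right_spectrum_def)
  qed
qed

section \<open>Automorphisms of the octonions and their action on eigenmaps\<close>

text \<open>
  Every octonion satisfies its own quadratic equation $x^2 = 2\,\mathrm{Re}(x)\,x - |x|^2$. Consequently
  multiplication alone knows the imaginary part and the norm, which makes automorphisms isometric.
\<close>

lemma oct_square: "x \<star> x = (2 * oct_Re x) *\<^sub>R x - oct_of_real ((norm x)\<^sup>2)"
proof -
  obtain a b c d where x: "x = ((a, b), (c, d))" by (metis surj_pair)
  have "(norm x)\<^sup>2 = (Re a)\<^sup>2 + (Im a)\<^sup>2 + (Re b)\<^sup>2 + (Im b)\<^sup>2 + (Re c)\<^sup>2 + (Im c)\<^sup>2 + (Re d)\<^sup>2 + (Im d)\<^sup>2"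
    by (simp add: x norm_Pair cmod_power2)
  then show ?thesis
    by (simp add: x oct_mult_def quat_mult_def quat_cnj_def oct_Re_def oct_of_real_def
        complex_eq_iff power2_eq_square algebra_simps)
qed

lemma linear_oct_of_real: "linear oct_of_real"
  by (rule linearI) (auto simp: oct_of_real_def scaleR_conv_of_real)

lemma oct_of_real_eq_iff [simp]: "oct_of_real r = oct_of_real s \<longleftrightarrow> r = s"
  by (simp add: oct_of_real_def)

lemma oct_of_real_mult [simp]: "oct_of_real r \<star> x = r *\<^sub>R x" "x \<star> oct_of_real r = r *\<^sub>R x"
proof -
  obtain a b c d where "x = ((a, b), (c, d))" by (metis surj_pair)
  then show "oct_of_real r \<star> x = r *\<^sub>R x" "x \<star> oct_of_real r = r *\<^sub>R x"
    by (simp_all add: oct_mult_def quat_mult_def quat_cnj_def oct_of_real_def scaleR_conv_of_real)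
qed

lemma unit_Im_Oct_iff_square: "u \<in> unit_Im_Oct \<longleftrightarrow> u \<star> u = oct_of_real (- 1)"
proof
  assume "u \<in> unit_Im_Oct"
  then show "u \<star> u = oct_of_real (- 1)"
    by (simp add: oct_square unit_Im_Oct_def Im_Oct_def linear_neg[OF linear_oct_of_real])
next
  assume "u \<star> u = oct_of_real (- 1)"
  then have u: "(2 * oct_Re u) *\<^sub>R u = oct_of_real ((norm u)\<^sup>2 - 1)"
    by (simp add: oct_square linear_diff[OF linear_oct_of_real] linear_neg[OF linear_oct_of_real]
        algebra_simps)
  have "oct_Re u = 0"
  proof (rule ccontr)
    assume "oct_Re u \<noteq> 0"
    then have "u = (1 / (2 * oct_Re u)) *\<^sub>R ((2 * oct_Re u) *\<^sub>R u)" by simp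
    also have "\<dots> = oct_of_real (1 / (2 * oct_Re u) * ((norm u)\<^sup>2 - 1))"
      by (simp add: u linear_cmul[OF linear_oct_of_real, symmetric])
    finally obtain t where t: "u = oct_of_real t" by blast
    then have "t * t = - 1"
      using \<open>u \<star> u = oct_of_real (- 1)\<close>
      by (simp add: linear_cmul[OF linear_oct_of_real, symmetric])
    then show False
      using zero_le_square[of t] by linarith
  qed
  with u have "oct_of_real ((norm u)\<^sup>2 - 1) = oct_of_real 0"
    by (simp add: linear_0[OF linear_oct_of_real])
  then have "norm u = 1"
    unfolding oct_of_real_eq_iff using power2_eq_1_iff[of "norm u"] norm_ge_zero[of u] by linarith
  with \<open>oct_Re u = 0\<close> show "u \<in> unit_Im_Oct"
    by (simp add: unit_Im_Oct_def Im_Oct_def)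
qed

lemma G2I: "linear \<phi> \<Longrightarrow> bij \<phi> \<Longrightarrow> (\<And>x y. \<phi> (x \<star> y) = \<phi> x \<star> \<phi> y) \<Longrightarrow> \<phi> \<in> G2"
  unfolding G2_def by blast

lemma G2D:
  assumes "\<phi> \<in> G2"
  shows "linear \<phi>" "bij \<phi>" "\<phi> (x \<star> y) = \<phi> x \<star> \<phi> y"
  using assms unfolding G2_def by blast+

lemma G2_comp: "\<phi> \<in> G2 \<Longrightarrow> \<psi> \<in> G2 \<Longrightarrow> \<phi> \<circ> \<psi> \<in> G2"
  by (rule G2I) (simp_all add: G2D linear_compose bij_comp)

lemma G2_inv:
  assumes "\<phi> \<in> G2"
  shows "inv \<phi> \<in> G2"
proof -
  have \<phi>: "linear \<phi>" "bij \<phi>" "\<And>x y. \<phi> (x \<star> y) = \<phi> x \<star> \<phi> y"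
    using G2D[OF assms] by auto
  have "inv \<phi> (x \<star> y) = inv \<phi> x \<star> inv \<phi> y" for x y
  proof -
    have "\<phi> (inv \<phi> x \<star> inv \<phi> y) = x \<star> y"
      using \<phi> by (simp add: bij_is_surj surj_f_inv_f)
    then show ?thesis
      using \<open>bij \<phi>\<close> by (metis bij_inv_eq_iff)
  qed
  moreover have "linear (inv \<phi>)"
    using \<phi> by (simp add: bij_is_inj inj_linear_imp_inv_linear)
  ultimately show ?thesis
    using \<open>bij \<phi>\<close> by (intro G2I bij_imp_bij_inv)
qed

lemma G2_inv_cancel: "\<phi> \<in> G2 \<Longrightarrow> \<phi> (inv \<phi> x) = x" "\<phi> \<in> G2 \<Longrightarrow> inv \<phi> (\<phi> x) = x"
  by (simp_all add: G2D(2) bij_is_surj surj_f_inv_f bij_is_inj)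

lemma G2_of_real:
  assumes "\<phi> \<in> G2"
  shows "\<phi> (oct_of_real r) = oct_of_real r"
proof -
  have \<phi>: "linear \<phi>" "\<And>x y. \<phi> (x \<star> y) = \<phi> x \<star> \<phi> y"
    using G2D[OF assms] by auto
  have "\<phi> (oct_of_real 1) = \<phi> (oct_of_real 1 \<star> inv \<phi> (oct_of_real 1))"
    unfolding \<phi>(2) G2_inv_cancel(1)[OF assms] by simp
  also have "\<dots> = oct_of_real 1"
    using assms by (simp add: G2_inv_cancel)
  finally show ?thesis
    using linear_cmul[OF \<phi>(1), of r "oct_of_real 1"]
    by (simp add: linear_cmul[OF linear_oct_of_real, symmetric])
qed

lemma G2_unit_Im_Oct:
  assumes "\<phi> \<in> G2" "u \<in> unit_Im_Oct"
  shows "\<phi> u \<in> unit_Im_Oct"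
proof -
  have "\<phi> u \<star> \<phi> u = \<phi> (u \<star> u)"
    using assms by (simp add: G2D(3))
  then show ?thesis
    using assms by (simp add: unit_Im_Oct_iff_square G2_of_real)
qed

lemma Im_Oct_decompose:
  assumes "v \<in> Im_Oct"
  obtains r u where "u \<in> unit_Im_Oct" "v = r *\<^sub>R u"
proof (cases "v = 0")
  case True
  have "((\<i>, 0), (0, 0)) \<in> unit_Im_Oct"
    by (simp add: unit_Im_Oct_def Im_Oct_def oct_Re_def norm_Pair)
  with True show ?thesis using that[of _ 0] by simp
next
  case False
  have "v /\<^sub>R norm v \<in> unit_Im_Oct"
    using assms False by (simp add: unit_Im_Oct_def Im_Oct_def oct_Re_def)
  with False show ?thesis using that[of "v /\<^sub>R norm v" "norm v"] by simp
qed

lemma G2_Im_Oct: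
  assumes "\<phi> \<in> G2" "v \<in> Im_Oct"
  shows "\<phi> v \<in> Im_Oct" and "norm (\<phi> v) = norm v"
proof -
  obtain r u where u: "u \<in> unit_Im_Oct" "v = r *\<^sub>R u"
    using assms(2) by (rule Im_Oct_decompose)
  then have v: "\<phi> v = r *\<^sub>R \<phi> u"
    using assms(1) by (simp add: G2D(1) linear_cmul)
  have \<phi>u: "\<phi> u \<in> unit_Im_Oct"
    using assms(1) u(1) by (rule G2_unit_Im_Oct)
  from \<phi>u v show "\<phi> v \<in> Im_Oct"
    by (simp add: unit_Im_Oct_def subspace_scale[OF subspace_Im_Oct])
  from \<phi>u v u show "norm (\<phi> v) = norm v"
    by (simp add: unit_Im_Oct_def)
qed

lemma G2_inner_Im_Oct:
  assumes "\<phi> \<in> G2" "v \<in> Im_Oct" "w \<in> Im_Oct"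
  shows "\<phi> v \<bullet> \<phi> w = v \<bullet> w"
proof -
  have "\<phi> v + \<phi> w = \<phi> (v + w)"
    using assms(1) by (simp add: G2D(1) linear_add)
  moreover have "v + w \<in> Im_Oct"
    using assms by (simp add: subspace_add[OF subspace_Im_Oct])
  ultimately show ?thesis
    using assms by (simp add: dot_norm G2_Im_Oct)
qed

text \<open>
  The conjugate of \<open>f\<close> by \<open>\<phi>\<close> is the transformed tensor. Its image under \<open>h\<close> is computed with
  the orthonormal basis \<open>\<phi> ` Im_units\<close> instead of \<open>Im_units\<close>.
\<close>

lemma eigenmap_G2:
  assumes \<phi>: "\<phi> \<in> G2" and f: "eigenmap l f"
  shows "eigenmap (\<phi> l) (\<phi> \<circ> f \<circ> inv \<phi>)"
proof -
  have lin: "linear \<phi>" "linear (inv \<phi>)" "linear f"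
    using \<phi> G2_inv[OF \<phi>] f by (simp_all add: G2D(1) eigenmap_def)
  have mult: "\<phi> (x \<star> y) = \<phi> x \<star> \<phi> y" for x y
    using \<phi> by (rule G2D(3))
  have inj: "inj \<phi>"
    using \<phi> by (simp add: G2D(2) bij_is_inj)
  have units: "b \<in> Im_Oct" if "b \<in> Im_units" for b
    using that by (metis span_Im_units span_base)
  have linear: "linear (\<phi> \<circ> f \<circ> inv \<phi>)"
    using lin by (intro linear_compose)
  have span: "span (\<phi> ` Im_units) = Im_Oct"
  proof -
    have "\<phi> ` Im_Oct = Im_Oct"
    proof
      show "Im_Oct \<subseteq> \<phi> ` Im_Oct"
      proof
        fix v assume "v \<in> Im_Oct"
        then have "inv \<phi> v \<in> Im_Oct" "v = \<phi> (inv \<phi> v)"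
          using \<phi> by (simp_all add: G2_Im_Oct G2_inv G2_inv_cancel)
        then show "v \<in> \<phi> ` Im_Oct" by blast
      qed
    qed (use \<phi> in \<open>simp add: G2_Im_Oct image_subset_iff\<close>)
    then show ?thesis
      by (simp add: linear_span_image[OF lin(1)] span_Im_units)
  qed
  have orth: "pairwise orthogonal (\<phi> ` Im_units)"
  proof (rule pairwise_imageI)
    fix b c assume "b \<in> Im_units" "c \<in> Im_units" "b \<noteq> c"
    then show "orthogonal (\<phi> b) (\<phi> c)"
      using orthogonal_Im_units \<phi> units by (simp add: orthogonal_def pairwise_def G2_inner_Im_Oct)
  qed
  have norm: "norm c = 1" if "c \<in> \<phi> ` Im_units" for c
    using that \<phi> units by (metis G2_Im_Oct(2) imageE norm_Im_units)
  have "h_map (\<phi> \<circ> f \<circ> inv \<phi>) v = (\<phi> \<circ> f \<circ> inv \<phi>) v \<star> \<phi> l" if "v \<in> Im_Oct" for v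
  proof -
    have "h_map (\<phi> \<circ> f \<circ> inv \<phi>) v = (\<Sum>b\<in>Im_units. (v \<star> \<phi> b) \<star> \<phi> (f b))"
      using h_map_orthonormal[OF linear finite_imageI[OF finite_Im_units] orth norm span] \<phi> inj
      by (simp add: sum.reindex inj_on_subset G2_inv_cancel)
    also have "\<dots> = \<phi> (h_map f (inv \<phi> v))"
      using \<phi> by (simp add: h_map_def linear_sum[OF lin(1)] mult G2_inv_cancel)
    also have "\<dots> = \<phi> (f (inv \<phi> v) \<star> l)"
      using f that \<phi> by (simp add: eigenmap_def G2_Im_Oct G2_inv)
    finally show ?thesis by (simp add: mult)
  qed
  moreover have "\<exists>v\<in>Im_Oct. (\<phi> \<circ> f \<circ> inv \<phi>) v \<noteq> 0"
  proof -
    obtain v where v: "v \<in> Im_Oct" "f v \<noteq> 0"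
      using f unfolding eigenmap_def by blast
    have "\<phi> (f v) \<noteq> \<phi> 0"
      using v inj by (simp add: inj_eq)
    then have "(\<phi> \<circ> f \<circ> inv \<phi>) (\<phi> v) \<noteq> 0"
      using \<phi> lin(1) by (simp add: G2_inv_cancel linear_0)
    moreover have "\<phi> v \<in> Im_Oct"
      using \<phi> v(1) by (rule G2_Im_Oct(1))
    ultimately show ?thesis by (rule bexI)
  qed
  ultimately show ?thesis
    unfolding eigenmap_def by (intro conjI ballI linear)
qed

section \<open>Transitivity of G2 on the unit imaginary octonions\<close>

definition quat_twist :: "quaternion \<Rightarrow> octonion \<Rightarrow> octonion" where
  "quat_twist p x = (fst x, quat_mult p (snd x))"

lemma quat_mult_assoc: "quat_mult (quat_mult p q) r = quat_mult p (quat_mult q r)"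
  by (simp add: quat_mult_def algebra_simps)

lemma quat_cnj_mult_self:
  "quat_mult (quat_cnj p) p = (complex_of_real ((norm p)\<^sup>2), 0)"
  "quat_mult p (quat_cnj p) = (complex_of_real ((norm p)\<^sup>2), 0)"
proof -
  obtain a b where p: "p = (a, b)" by (rule prod.exhaust)
  have "(norm p)\<^sup>2 = (Re a)\<^sup>2 + (Im a)\<^sup>2 + (Re b)\<^sup>2 + (Im b)\<^sup>2"
    by (simp add: p norm_Pair cmod_power2)
  then show "quat_mult (quat_cnj p) p = (complex_of_real ((norm p)\<^sup>2), 0)"
    "quat_mult p (quat_cnj p) = (complex_of_real ((norm p)\<^sup>2), 0)"
    by (simp_all add: p quat_mult_def quat_cnj_def complex_eq_iff power2_eq_square del: of_real_power)
qed

lemma quat_mult_real: "quat_mult (complex_of_real r, 0) q = r *\<^sub>R q"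
  by (cases q) (simp add: quat_mult_def scaleR_conv_of_real)

text \<open>
  In the doubling formula $(a,b)(c,d) = (ac - \bar d b,\, da + b\bar c)$ a unit factor $p$ on the left of the
  second components cancels in $\bar d b$ and can be pulled out of $da + b \bar c$. These automorphisms fix the first
  quaternion and are transitive on each sphere of second quaternions.
\<close>

lemma quat_twist_G2:
  assumes "norm p = 1"
  shows "quat_twist p \<in> G2"
proof -
  have lin: "linear (quat_twist q)" for q
    by (rule linearI)
      (simp_all add: quat_twist_def quat_mult_def algebra_simps scaleR_conv_of_real prod_eq_iff)
  have inv: "quat_twist (quat_cnj p) (quat_twist p x) = x" "quat_twist p (quat_twist (quat_cnj p) x) = x" for x
    using assms quat_mult_real[of 1]
    by (simp_all add: quat_twist_def quat_cnj_mult_self flip: quat_mult_assoc)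
  have mult: "quat_twist p (x \<star> y) = quat_twist p x \<star> quat_twist p y" for x y
  proof -
    have cancel: "quat_mult (quat_cnj (quat_mult p d)) (quat_mult p b) = quat_mult (quat_cnj d) b" for b d
    proof -
      have "quat_mult (quat_cnj (quat_mult p d)) (quat_mult p b) =
          quat_mult (quat_cnj d) (quat_mult (quat_mult (quat_cnj p) p) b)"
        by (simp add: quat_mult_def quat_cnj_def algebra_simps)
      then show ?thesis
        using assms quat_mult_real[of 1 b] by (simp add: quat_cnj_mult_self)
    qed
    have add: "quat_mult p (b + c) = quat_mult p b + quat_mult p c" for b c
      by (simp add: quat_mult_def algebra_simps)
    show ?thesis
      by (simp add: quat_twist_def oct_mult_def cancel add quat_mult_assoc)
  qed
  show ?thesis
  proof (rule G2I)
    show "bij (quat_twist p)"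
      by (rule o_bij[of "quat_twist (quat_cnj p)"]) (simp_all only: fun_eq_iff comp_apply id_apply inv simp_thms)
  qed (rule lin, rule mult)
qed

text \<open>
  With the real coordinates numbered $0, \dots, 7$ and unit vectors $e_k$, this is the permutation
  $e_1 \mapsto e_3 \mapsto e_7 \mapsto e_1$, $e_2 \mapsto e_4 \mapsto e_6 \mapsto e_2$ fixing $e_0$ and $e_5$.
  It moves the quaternion subalgebra $\langle e_0, e_1, e_2, e_3 \rangle$ to
  $\langle e_0, e_3, e_4, e_7 \rangle$ and thereby mixes the two halves of an octonion.
\<close>

definition fano_rotation :: "octonion \<Rightarrow> octonion" where
  "fano_rotation x =
     ((Complex (Re (fst (fst x))) (Im (snd (snd x))), Complex (Re (snd (snd x))) (Im (fst (fst x)))),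
      (Complex (Re (snd (fst x))) (Im (fst (snd x))), Complex (Re (fst (snd x))) (Im (snd (fst x)))))"

lemma fano_rotation_G2: "fano_rotation \<in> G2"
proof -
  have lin: "linear fano_rotation"
    by (rule linearI) (simp_all add: fano_rotation_def complex_eq_iff)
  have cube: "fano_rotation (fano_rotation (fano_rotation x)) = x" for x
    by (simp add: fano_rotation_def prod_eq_iff complex_eq_iff)
  have "bij fano_rotation"
    by (rule o_bij[of "fano_rotation \<circ> fano_rotation"]) (simp_all only: fun_eq_iff comp_apply id_apply cube simp_thms)
  moreover have "fano_rotation (x \<star> y) = fano_rotation x \<star> fano_rotation y" for x y
    by (simp add: fano_rotation_def oct_mult_def quat_mult_def quat_cnj_def prod_eq_iff complex_eq_iff)
  ultimately show ?thesis
    using lin by (intro G2I)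
qed

lemma G2_flatten_snd:
  obtains \<phi> where "\<phi> \<in> G2" "\<phi> (a, b) = (a, (complex_of_real (norm b), 0))"
proof (cases "b = 0")
  case True
  have "id \<in> G2" by (rule G2I) (simp_all add: linear_id)
  with True show ?thesis by (intro that[of id]) (simp_all add: zero_prod_def)
next
  case False
  define p where "p = quat_cnj b /\<^sub>R norm b"
  have "norm (quat_cnj b) = norm b"
    by (cases b) (simp add: quat_cnj_def norm_Pair)
  with False have "norm p = 1" by (simp add: p_def)
  moreover have "quat_mult p b = (complex_of_real (norm b), 0)"
  proof -
    have "quat_mult p b = quat_mult (quat_cnj b) b /\<^sub>R norm b"
      by (simp add: p_def quat_mult_def algebra_simps scaleR_conv_of_real)
    then show ?thesis
      using False by (simp add: quat_cnj_mult_self power2_eq_square scaleR_conv_of_real)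
  qed
  ultimately show ?thesis
    by (intro that[of "quat_twist p"] quat_twist_G2) (simp_all add: quat_twist_def)
qed

text \<open>
  Flattening the second half leaves the coordinates 1, 2, 3, 4; the permutation sends these to
  3, 4, 7, 6, so only the coordinate 3 stays in the first half. A second flattening leaves 3 and 4,
  which the permutation sends to 7 and 6, both in the second half. A third flattening leaves the
  coordinate 4 alone.
\<close>

lemma G2_to_e4:
  assumes "u \<in> unit_Im_Oct"
  shows "\<exists>\<phi>\<in>G2. \<phi> u = ((0, 0), (1, 0))"
proof -
  have "Re (fst (fst u)) = 0"
    using assms by (simp add: unit_Im_Oct_def Im_Oct_def oct_Re_def)
  then obtain a b c where u: "u = ((Complex 0 a, b), c)"
    by (metis complex_surj surjective_pairing)
  obtain \<phi>1 where \<phi>1: "\<phi>1 \<in> G2" "\<phi>1 u = ((Complex 0 a, b), (complex_of_real (norm c), 0))"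
    unfolding u by (rule G2_flatten_snd)
  define c' where "c' = (Complex (Re b) 0, Complex (norm c) (Im b))"
  have 1: "fano_rotation (\<phi>1 u) = ((0, Complex 0 a), c')"
    by (simp add: \<phi>1 c'_def fano_rotation_def complex_eq_iff)
  obtain \<phi>2 where \<phi>2: "\<phi>2 \<in> G2" "\<phi>2 ((0, Complex 0 a), c') = ((0, Complex 0 a), (complex_of_real (norm c'), 0))"
    by (rule G2_flatten_snd)
  define c'' where "c'' = (0 :: complex, Complex (norm c') a)"
  have 2: "fano_rotation ((0, Complex 0 a), (complex_of_real (norm c'), 0)) = (0, c'')"
    by (simp add: fano_rotation_def c''_def complex_eq_iff zero_prod_def)
  obtain \<phi>3 where \<phi>3: "\<phi>3 \<in> G2" "\<phi>3 (0, c'') = (0, (complex_of_real (norm c''), 0))"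
    by (rule G2_flatten_snd)
  define \<phi> where "\<phi> = \<phi>3 \<circ> fano_rotation \<circ> \<phi>2 \<circ> fano_rotation \<circ> \<phi>1"
  have \<phi>: "\<phi> \<in> G2"
    unfolding \<phi>_def using \<phi>1 \<phi>2 \<phi>3 fano_rotation_G2 by (intro G2_comp)
  have \<phi>u: "\<phi> u = (0, (complex_of_real (norm c''), 0))"
    by (simp add: \<phi>_def 1 2 \<phi>2 \<phi>3)
  have "norm (\<phi> u) = 1"
    using G2_unit_Im_Oct[OF \<phi> assms] by (simp add: unit_Im_Oct_def)
  then have "norm c'' = 1"
    by (simp add: \<phi>u norm_Pair)
  with \<phi> \<phi>u show ?thesis by (auto simp: zero_prod_def)
qed

lemma G2_transitive:
  assumes "u \<in> unit_Im_Oct" "v \<in> unit_Im_Oct"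
  obtains \<phi> where "\<phi> \<in> G2" "\<phi> u = v"
proof -
  obtain \<phi> where \<phi>: "\<phi> \<in> G2" "\<phi> u = ((0, 0), (1, 0))"
    using G2_to_e4[OF assms(1)] by (rule bexE)
  obtain \<psi> where \<psi>: "\<psi> \<in> G2" "\<psi> v = ((0, 0), (1, 0))"
    using G2_to_e4[OF assms(2)] by (rule bexE)
  show ?thesis
  proof
    show "inv \<psi> \<circ> \<phi> \<in> G2"
      using \<phi> \<psi> by (intro G2_comp G2_inv)
    show "(inv \<psi> \<circ> \<phi>) u = v"
      using \<phi>(2) G2_inv_cancel(2)[OF \<psi>(1), of v] by (simp add: \<psi>(2))
  qed
qed

section \<open>Coordinates adapted to one slice\<close>

lemma ball_Im_units:
  "(\<forall>b\<in>Im_units. P b) \<longleftrightarrow>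
     P ((\<i>, 0), (0, 0)) \<and> P ((0, 1), (0, 0)) \<and> P ((0, \<i>), (0, 0)) \<and> P ((0, 0), (1, 0)) \<and>
     P ((0, 0), (\<i>, 0)) \<and> P ((0, 0), (0, 1)) \<and> P ((0, 0), (0, \<i>))"
  by (simp add: Im_units_def)

text \<open>
  The octonions are viewed as $\mathbb{C} \oplus \mathbb{C}^3$. Conjugating the last coordinate makes right
  multiplication by $z$ in the first $\mathbb{C}$ act as $z$ on $\mathbb{C}$ and as $\bar z$ on all of $\mathbb{C}^3$,
  and makes the three coordinates cyclically symmetric for the octonion product.
\<close>

definition oct_vec :: "octonion \<Rightarrow> complex^3" where
  "oct_vec x = vector [snd (fst x), fst (snd x), cnj (snd (snd x))]"

definition oct_of_coords :: "complex \<Rightarrow> complex^3 \<Rightarrow> octonion" where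
  "oct_of_coords a x = ((a, x$1), (x$2, cnj (x$3)))"

text \<open>
  The general real-linear map on $\mathrm{Im}\,\mathbb{O} = i\mathbb{R} \oplus \mathbb{C}^3$ with values in
  $\mathbb{C} \oplus \mathbb{C}^3$: it sends $i$ to $(a, p)$ and $x \in \mathbb{C}^3$ to
  $(A \cdot x + B \cdot \bar x,\; M x + N \bar x)$ with bilinear dots.
\<close>

definition slice_map ::
  "complex \<Rightarrow> complex^3 \<Rightarrow> complex^3 \<Rightarrow> complex^3 \<Rightarrow> complex^3^3 \<Rightarrow> complex^3^3 \<Rightarrow> octonion \<Rightarrow> octonion"
  where
  "slice_map a p A B M N v =
     (let t = complex_of_real (Im (fst (fst v))); x = oct_vec v in
      oct_of_coords (t * a + (\<Sum>k\<in>UNIV. A$k * x$k + B$k * cnj (x$k)))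
        (\<chi> r. t * p$r + (\<Sum>c\<in>UNIV. M$r$c * x$c + N$r$c * cnj (x$c))))"

text \<open>
  The vector of the antisymmetric matrix $N - N^T$, and the antisymmetric matrix of a vector: the only
  way in which \<open>N\<close> interacts with the vectors \<open>p\<close>, \<open>A\<close>, \<open>B\<close>.
\<close>

definition axial :: "complex^3^3 \<Rightarrow> complex^3" where
  "axial N = vector [N$2$3 - N$3$2, N$3$1 - N$1$3, N$1$2 - N$2$1]"

definition skew :: "complex^3 \<Rightarrow> complex^3^3" where
  "skew q = vector [vector [0, q$3, - q$2], vector [- q$3, 0, q$1], vector [q$2, - q$1, 0]]"

lemma slice_map_units:
  "slice_map a p A B M N ((\<i>, 0), (0, 0)) = oct_of_coords a p"
  "slice_map a p A B M N ((0, 1), (0, 0)) = oct_of_coords (A$1 + B$1) (\<chi> r. M$r$1 + N$r$1)"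
  "slice_map a p A B M N ((0, \<i>), (0, 0)) = oct_of_coords (\<i> * (A$1 - B$1)) (\<chi> r. \<i> * (M$r$1 - N$r$1))"
  "slice_map a p A B M N ((0, 0), (1, 0)) = oct_of_coords (A$2 + B$2) (\<chi> r. M$r$2 + N$r$2)"
  "slice_map a p A B M N ((0, 0), (\<i>, 0)) = oct_of_coords (\<i> * (A$2 - B$2)) (\<chi> r. \<i> * (M$r$2 - N$r$2))"
  "slice_map a p A B M N ((0, 0), (0, 1)) = oct_of_coords (A$3 + B$3) (\<chi> r. M$r$3 + N$r$3)"
  "slice_map a p A B M N ((0, 0), (0, \<i>)) = oct_of_coords (- \<i> * (A$3 - B$3)) (\<chi> r. - \<i> * (M$r$3 - N$r$3))"
  by (simp_all add: slice_map_def Let_def oct_of_coords_def oct_vec_def sum_3)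
    (simp_all add: right_diff_distrib mult.commute[of _ \<i>])

lemma linear_slice_map: "linear (slice_map a p A B M N)"
  by (rule linearI)
    (simp_all add: slice_map_def Let_def oct_of_coords_def oct_vec_def sum_3 prod_eq_iff
      scaleR_conv_of_real ring_distribs scaleR_add_right add_ac mult.left_commute)

lemma linear_eq_on_Im_Oct:
  assumes "linear f" "linear g" "\<forall>b\<in>Im_units. f b = g b" "v \<in> Im_Oct"
  shows "f v = g v"
  using linear_eq_on_span[OF assms(1,2), of Im_units v] assms(3,4) by (simp add: span_Im_units)

lemma linear_eq_slice_map:
  assumes "linear f"
  obtains a p A B M N where "\<And>v. v \<in> Im_Oct \<Longrightarrow> f v = slice_map a p A B M N v"
proof -
  define w1 where "w1 = f ((\<i>, 0), (0, 0))"
  \<comment> \<open>\<open>y k\<close> and \<open>y' k\<close> are the values at the \<open>k\<close>-th coordinate vector of $\mathbb{C}^3$ and at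
    \<open>\<i>\<close> times it. The last unit has coordinate \<open>- \<i>\<close>, because the third coordinate is conjugated.\<close>
  define y where "y = (\<lambda>k::3. if k = 1 then f ((0, 1), (0, 0))
    else if k = 2 then f ((0, 0), (1, 0)) else f ((0, 0), (0, 1)))"
  define y' where "y' = (\<lambda>k::3. if k = 1 then f ((0, \<i>), (0, 0))
    else if k = 2 then f ((0, 0), (\<i>, 0)) else - f ((0, 0), (0, \<i>)))"
  define c where "c x = fst (fst x)" for x :: octonion
  let ?g = "slice_map (c w1) (oct_vec w1)
    (\<chi> k. (c (y k) - \<i> * c (y' k)) / 2) (\<chi> k. (c (y k) + \<i> * c (y' k)) / 2)
    (\<chi> r k. (oct_vec (y k) $ r - \<i> * oct_vec (y' k) $ r) / 2)
    (\<chi> r k. (oct_vec (y k) $ r + \<i> * oct_vec (y' k) $ r) / 2)"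
  have "\<forall>b\<in>Im_units. f b = ?g b"
    unfolding ball_Im_units
    by (simp add: slice_map_units oct_of_coords_def y_def y'_def c_def w1_def oct_vec_def
        prod_eq_iff field_simps)
  then have "f v = ?g v" if "v \<in> Im_Oct" for v
    by (rule linear_eq_on_Im_Oct[OF assms linear_slice_map _ that])
  then show ?thesis by (rule that)
qed

lemma oct_of_coords_eq_iff: "oct_of_coords a x = oct_of_coords b y \<longleftrightarrow> a = b \<and> x = y"
  by (auto simp: oct_of_coords_def vec_eq_iff forall_3)

lemma slice_map_eq_iff:
  "(\<forall>v\<in>Im_Oct. slice_map a p A B M N v = slice_map a' p' A' B' M' N' v) \<longleftrightarrow>
     a = a' \<and> p = p' \<and> A = A' \<and> B = B' \<and> M = M' \<and> N = N'"
proof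
  have half: "x = x' \<and> y = y'" if "x + y = x' + y'" "x - y = x' - y'" for x y x' y' :: complex
  proof -
    have "2 * x = 2 * x'" "2 * y = 2 * y'" using that by algebra+
    then show ?thesis by simp
  qed
  assume eq: "\<forall>v\<in>Im_Oct. slice_map a p A B M N v = slice_map a' p' A' B' M' N' v"
  have "b \<in> Im_Oct" if "b \<in> Im_units" for b
    using that unfolding span_Im_units[symmetric] by (rule span_base)
  then have unit_eq: "slice_map a p A B M N b = slice_map a' p' A' B' M' N' b" if "b \<in> Im_units" for b
    using eq that by blast
  have "a = a' \<and> p = p'"
    using unit_eq[of "((\<i>, 0), (0, 0))"] by (simp add: Im_units_def slice_map_units oct_of_coords_eq_iff)
  moreover have "(A$k = A'$k \<and> B$k = B'$k) \<and> (\<forall>r. M$r$k = M'$r$k \<and> N$r$k = N'$r$k)" for k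
  proof -
    have k: "k = 1 \<or> k = 2 \<or> k = 3" by (rule exhaust_3)
    have "A$k + B$k = A'$k + B'$k \<and> A$k - B$k = A'$k - B'$k \<and>
        (\<forall>r. M$r$k + N$r$k = M'$r$k + N'$r$k \<and> M$r$k - N$r$k = M'$r$k - N'$r$k)"
      using k unit_eq[of "((0, 1), (0, 0))"] unit_eq[of "((0, \<i>), (0, 0))"]
        unit_eq[of "((0, 0), (1, 0))"] unit_eq[of "((0, 0), (\<i>, 0))"]
        unit_eq[of "((0, 0), (0, 1))"] unit_eq[of "((0, 0), (0, \<i>))"]
      by (elim disjE) (simp_all add: Im_units_def slice_map_units oct_of_coords_eq_iff vec_eq_iff)
    then show ?thesis using half by blast
  qed
  ultimately show "a = a' \<and> p = p' \<and> A = A' \<and> B = B' \<and> M = M' \<and> N = N'"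
    by (simp add: vec_eq_iff)
qed simp

text \<open>
  The operator \<open>h\<close> in these coordinates. Equivariance under $SU(3)$, the stabiliser of $i$ in \<open>G2\<close>,
  explains the shape: the trace of \<open>M\<close> couples only to the scalar \<open>a\<close>, the antisymmetric part of
  \<open>N\<close> only to the vectors, and the trace-free part of \<open>M\<close> and the symmetric part of \<open>N\<close> only to
  themselves.
\<close>

lemma h_map_slice_map:
  assumes "v \<in> Im_Oct"
  shows "h_map (slice_map a p A B M N) v =
    slice_map (- a - 2 * \<i> * cnj (\<Sum>k\<in>UNIV. M$k$k))
      (\<chi> k. - p$k + 2 * \<i> * cnj (A$k) + 2 * \<i> * cnj (axial N $ k))
      (\<chi> k. \<i> * cnj (p$k) - 2 * A$k)
      (\<chi> k. 2 * cnj (axial N $ k))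
      (\<chi> r c. 2 * cnj (M$c$r) - 2 * M$r$c -
         (if r = c then 2 * cnj (\<Sum>k\<in>UNIV. M$k$k) + \<i> * cnj a else 0))
      (skew (\<chi> k. \<i> * cnj (p$k) + 2 * cnj (B$k))) v"
proof (rule linear_eq_on_Im_Oct[OF linear_h_map linear_slice_map _ assms])
  show "\<forall>b\<in>Im_units. h_map (slice_map a p A B M N) b =
    slice_map (- a - 2 * \<i> * cnj (\<Sum>k\<in>UNIV. M$k$k))
      (\<chi> k. - p$k + 2 * \<i> * cnj (A$k) + 2 * \<i> * cnj (axial N $ k))
      (\<chi> k. \<i> * cnj (p$k) - 2 * A$k)
      (\<chi> k. 2 * cnj (axial N $ k))
      (\<chi> r c. 2 * cnj (M$c$r) - 2 * M$r$c -
         (if r = c then 2 * cnj (\<Sum>k\<in>UNIV. M$k$k) + \<i> * cnj a else 0))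
      (skew (\<chi> k. \<i> * cnj (p$k) + 2 * cnj (B$k))) b"
    unfolding ball_Im_units
    by (simp add: slice_map_units h_map_def sum_Im_units oct_of_coords_def axial_def skew_def
        sum_3 oct_mult_def quat_mult_def quat_cnj_def prod_eq_iff algebra_simps)
qed

lemma slice_map_mult_right:
  "slice_map a p A B M N v \<star> ((z, 0), (0, 0)) =
     slice_map (z * a) (\<chi> k. cnj z * p$k) (\<chi> k. z * A$k) (\<chi> k. z * B$k)
       (\<chi> r c. cnj z * M$r$c) (\<chi> r c. cnj z * N$r$c) v"
  by (simp add: slice_map_def Let_def oct_of_coords_def sum_3 oct_mult_def quat_mult_def quat_cnj_def
      algebra_simps)

text \<open>
  The equation $h f = f \lambda$ for $\lambda = z$ in $\mathbb{C} = \mathbb{R} \oplus \mathbb{R} i$, compared coordinate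
  by coordinate.
\<close>

definition slice_system ::
  "complex \<Rightarrow> complex \<Rightarrow> complex^3 \<Rightarrow> complex^3 \<Rightarrow> complex^3 \<Rightarrow> complex^3^3 \<Rightarrow> complex^3^3 \<Rightarrow> bool"
  where
  "slice_system z a p A B M N \<longleftrightarrow>
     - a - 2 * \<i> * cnj (\<Sum>k\<in>UNIV. M$k$k) = z * a \<and>
     (\<forall>k. - p$k + 2 * \<i> * cnj (A$k) + 2 * \<i> * cnj (axial N $ k) = cnj z * p$k) \<and>
     (\<forall>k. \<i> * cnj (p$k) - 2 * A$k = z * A$k) \<and>
     (\<forall>k. 2 * cnj (axial N $ k) = z * B$k) \<and>
     (\<forall>r c. 2 * cnj (M$c$r) - 2 * M$r$c -
        (if r = c then 2 * cnj (\<Sum>k\<in>UNIV. M$k$k) + \<i> * cnj a else 0) = cnj z * M$r$c) \<and>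
     (\<forall>r c. skew (\<chi> k. \<i> * cnj (p$k) + 2 * cnj (B$k)) $ r $ c = cnj z * N$r$c)"

lemma eigenmap_slice_iff:
  "(\<exists>f. eigenmap ((z, 0), (0, 0)) f) \<longleftrightarrow>
     (\<exists>a p A B M N. slice_system z a p A B M N \<and> (a, p, A, B, M, N) \<noteq> 0)"
proof -
  have zero: "slice_map 0 0 0 0 0 0 v = 0" for v
    by (simp add: slice_map_def Let_def oct_of_coords_def zero_prod_def vec_eq_iff forall_3)
  have nonzero: "(\<exists>v\<in>Im_Oct. slice_map a p A B M N v \<noteq> 0) \<longleftrightarrow> (a, p, A, B, M, N) \<noteq> 0" for a p A B M N
  proof -
    have "(a, p, A, B, M, N) = 0 \<longleftrightarrow> a = 0 \<and> p = 0 \<and> A = 0 \<and> B = 0 \<and> M = 0 \<and> N = 0"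
      by (simp add: zero_prod_def)
    then show ?thesis
      using slice_map_eq_iff[of a p A B M N 0 0 0 0 0 0] unfolding zero by blast
  qed
  have system: "(\<forall>v\<in>Im_Oct. h_map (slice_map a p A B M N) v = slice_map a p A B M N v \<star> ((z, 0), (0, 0)))
      \<longleftrightarrow> slice_system z a p A B M N" for a p A B M N
  proof -
    have "(\<forall>v\<in>Im_Oct. h_map (slice_map a p A B M N) v = slice_map a p A B M N v \<star> ((z, 0), (0, 0)))
      \<longleftrightarrow> (\<forall>v\<in>Im_Oct.
        slice_map (- a - 2 * \<i> * cnj (\<Sum>k\<in>UNIV. M$k$k))
          (\<chi> k. - p$k + 2 * \<i> * cnj (A$k) + 2 * \<i> * cnj (axial N $ k))
          (\<chi> k. \<i> * cnj (p$k) - 2 * A$k)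
          (\<chi> k. 2 * cnj (axial N $ k))
          (\<chi> r c. 2 * cnj (M$c$r) - 2 * M$r$c -
             (if r = c then 2 * cnj (\<Sum>k\<in>UNIV. M$k$k) + \<i> * cnj a else 0))
          (skew (\<chi> k. \<i> * cnj (p$k) + 2 * cnj (B$k))) v =
        slice_map (z * a) (\<chi> k. cnj z * p$k) (\<chi> k. z * A$k) (\<chi> k. z * B$k)
          (\<chi> r c. cnj z * M$r$c) (\<chi> r c. cnj z * N$r$c) v)"
      by (intro ball_cong HOL.refl) (simp only: h_map_slice_map slice_map_mult_right)
    then show ?thesis
      unfolding slice_map_eq_iff slice_system_def by (simp only: vec_eq_iff vec_lambda_beta)
  qed
  have eigen: "eigenmap ((z, 0), (0, 0)) (slice_map a p A B M N) \<longleftrightarrow>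
      slice_system z a p A B M N \<and> (a, p, A, B, M, N) \<noteq> 0" for a p A B M N
    unfolding eigenmap_def system nonzero using linear_slice_map by blast
  show ?thesis
  proof
    assume "\<exists>f. eigenmap ((z, 0), (0, 0)) f"
    then obtain f where f: "eigenmap ((z, 0), (0, 0)) f" ..
    then obtain a p A B M N where eq: "\<And>v. v \<in> Im_Oct \<Longrightarrow> f v = slice_map a p A B M N v"
      using linear_eq_slice_map[of f] unfolding eigenmap_def by blast
    have "h_map f v = h_map (slice_map a p A B M N) v" for v
      using eq span_base[of _ Im_units] by (simp add: h_map_def span_Im_units)
    then have "eigenmap ((z, 0), (0, 0)) (slice_map a p A B M N)"
      using f eq linear_slice_map unfolding eigenmap_def by (metis (no_types, lifting))
    then show "\<exists>a p A B M N. slice_system z a p A B M N \<and> (a, p, A, B, M, N) \<noteq> 0"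
      unfolding eigen by blast
  qed (use eigen in blast)
qed

section \<open>The planar locus as the vanishing of block determinants\<close>

text \<open>
  In terms of $z = \mu + iQ$ the circle is $|z + 2| = 2$ and the quartic is
  $|(z + 4)(z - 1)| = 4\,|z + 1|$, the forms in which the two blocks containing \<open>M\<close> produce them.
\<close>

lemma spectral_locus_iff:
  "(Re z, Im z) \<in> spectral_locus \<longleftrightarrow>
     (z + 2) * (cnj z + 2) = 4 \<or>
     (z + 4) * (z - 1) * ((cnj z + 4) * (cnj z - 1)) = 16 * ((z + 1) * (cnj z + 1))"
proof -
  let ?\<mu> = "Re z" and ?Q = "Im z"
  have circle: "(z + 2) * (cnj z + 2) - 4 = of_real (?Q^2 + ?\<mu>^2 + 4 * ?\<mu>)"
    by (simp add: complex_eq_iff power2_eq_square algebra_simps)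
  have quartic: "(z + 4) * (z - 1) * ((cnj z + 4) * (cnj z - 1)) - 16 * ((z + 1) * (cnj z + 1)) =
      of_real (?\<mu>^4 + 6 * ?\<mu>^3 + (2 * ?Q^2 - 15) * ?\<mu>^2 + (6 * ?Q^2 - 56) * ?\<mu> + ?Q^4 + ?Q^2)"
    by (simp add: complex_eq_iff power2_eq_square power3_eq_cube power4_eq_xxxx algebra_simps)
  have "(z + 2) * (cnj z + 2) = 4 \<longleftrightarrow> ?Q^2 + ?\<mu>^2 + 4 * ?\<mu> = 0"
    unfolding right_minus_eq[of "(z + 2) * (cnj z + 2)" 4, symmetric] circle by (rule of_real_eq_0_iff)
  moreover have "(z + 4) * (z - 1) * ((cnj z + 4) * (cnj z - 1)) = 16 * ((z + 1) * (cnj z + 1)) \<longleftrightarrow>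
      ?\<mu>^4 + 6 * ?\<mu>^3 + (2 * ?Q^2 - 15) * ?\<mu>^2 + (6 * ?Q^2 - 56) * ?\<mu> + ?Q^4 + ?Q^2 = 0"
    unfolding right_minus_eq[of "(z + 4) * (z - 1) * ((cnj z + 4) * (cnj z - 1))", symmetric] quartic
    by (rule of_real_eq_0_iff)
  ultimately show ?thesis
    unfolding spectral_locus_def by auto
qed

text \<open>
  The equation \<open>D\<close> is the vanishing of the determinant of the block of \<open>p\<close>, \<open>A\<close>, \<open>B\<close> and
  \<open>axial N\<close>. It is a complex equation, that is, two real equations for the two real coordinates of $z$; so no further
  curve is to be expected.
  For real $z$ it factors as $z (z + 4) (z^2 - z - 8) = 0$, and these points lie on the circle or the quartic.
  For non-real $z$ the equation and its conjugate leave two possibilities for $s = z + \bar z$ and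
  $p = z \bar z$, of which $(1, -8)$ contradicts $p \ge 0$ and $(-8, 16)$ contradicts $z \ne \bar z$.
\<close>

lemma vector_determinant_zero:
  assumes D: "z * (z + 3) * ((cnj z)\<^sup>2 - 8) = 4 * cnj z * (z + 2)"
  shows "(Re z, Im z) \<in> spectral_locus"
proof -
  have D': "cnj z * (cnj z + 3) * (z\<^sup>2 - 8) = 4 * z * (cnj z + 2)"
    using arg_cong[OF D, of cnj] by simp
  have real: ?thesis if w: "cnj z = z"
  proof -
    have "z * (z + 4) * (z\<^sup>2 - z - 8) = 0"
      using D unfolding w by algebra
    then consider "z = 0" | "z = - 4" | "z\<^sup>2 - z - 8 = 0"
      by (auto simp: add_eq_0_iff2 add_eq_0_iff)
    then show ?thesis
    proof cases
      case 3
      then have "(z + 4) * (z - 1) * ((z + 4) * (z - 1)) = 16 * ((z + 1) * (z + 1))"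
        by algebra
      then show ?thesis by (simp add: spectral_locus_iff w)
    qed (simp_all add: spectral_locus_def)
  qed
  show ?thesis
  proof (cases "cnj z = z")
    case False
    define s p where "s = z + cnj z" and "p = z * cnj z"
    have "(z - cnj z) * (3 * p + 8 * s + 16) = 0"
      using D D' unfolding s_def p_def by algebra
    with False have p: "3 * p + 8 * s + 16 = 0" by auto
    have "2 * p\<^sup>2 + 3 * p * s + 8 * p - 8 * s\<^sup>2 - 32 * s = 0"
      using D D' unfolding s_def p_def by algebra
    with p have "(s - 1) * (s + 8) = 0" by algebra
    then consider "s = 1" | "s = - 8" by (auto simp: eq_neg_iff_add_eq_0)
    then show ?thesis
    proof cases
      case 1
      with p have "p = - 8" by algebra
      moreover have "Re p \<ge> 0" by (simp add: p_def)
      ultimately show ?thesis by simp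
    next
      case 2
      with p have "p = 16" by algebra
      with 2 have "(z - cnj z)\<^sup>2 = 0" unfolding s_def p_def by algebra
      with False show ?thesis by simp
    qed
  qed (rule real)
qed

text \<open>
  Eliminating \<open>A\<close> from the first two equations and \<open>b\<close> from the last two leaves a two by two system
  for \<open>P\<close> and \<open>n\<close>. The variable \<open>w\<close> stands for the conjugate of \<open>z\<close>, and is independent of \<open>z\<close> here
  because the elimination is purely algebraic.
\<close>

lemma vector_block_trivial:
  fixes z w P A n b :: complex
  assumes P: "(z + 1) * P = - 2 * \<i> * (A + n)" and A: "(z + 2) * A = \<i> * P"
    and b: "w * b = 2 * n" and n: "w * n = 2 * \<i> * P + 4 * b"
    and D: "z * (z + 3) * (w\<^sup>2 - 8) \<noteq> 4 * w * (z + 2)"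
  shows "P = 0 \<and> A = 0 \<and> b = 0 \<and> n = 0"
proof -
  have i: "\<i> * \<i> = -1" by simp
  have 1: "z * (z + 3) * P = - 2 * \<i> * (z + 2) * n"
    using P A i by algebra
  have 2: "(w\<^sup>2 - 8) * n = 2 * \<i> * w * P"
    using b n by algebra
  have "(z * (z + 3) * (w\<^sup>2 - 8) - 4 * w * (z + 2)) * n = 0"
    using 1 2 i by algebra
  with D have n0: "n = 0" by simp
  have "(z * (z + 3) * (w\<^sup>2 - 8) - 4 * w * (z + 2)) * P = 0"
    using 1 2 i by algebra
  with D have P0: "P = 0" by simp
  from P n0 P0 have "A = 0" by simp
  moreover from n n0 P0 have "b = 0" by simp
  ultimately show ?thesis using n0 P0 by simp
qed

text \<open>
  The block that yields the circle: it governs each pair of transposed off-diagonal entries of \<open>M\<close>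
  and, with \<open>x = y\<close>, each difference of diagonal entries.
\<close>

lemma conjugate_pair_trivial:
  assumes "(cnj z + 2) * x = 2 * cnj y" "(cnj z + 2) * y = 2 * cnj x" "(z + 2) * (cnj z + 2) \<noteq> 4"
  shows "x = 0"
proof -
  have "(z + 2) * cnj y = 2 * x"
    using arg_cong[OF assms(2), of cnj] by simp
  with assms(1) have "((z + 2) * (cnj z + 2) - 4) * x = 0" by algebra
  with assms(3) show ?thesis by simp
qed

lemma skew_zero: "skew (\<chi> k. 0) $ r $ c = 0"
  using exhaust_3[of r] exhaust_3[of c] by (elim disjE) (simp_all add: skew_def)

lemma axial_skew: "axial (skew q) $ k = 2 * q $ k"
  using exhaust_3[of k] by (elim disjE) (simp_all add: axial_def skew_def)

section \<open>Eigenvectors on one slice\<close>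

text \<open>
  Block by block: the vector block vanishes because its determinant does not, the symmetric part of
  \<open>N\<close> because \<open>z \<noteq> 0\<close> (the origin lies on the circle), the trace-free part of \<open>M\<close> off the circle and
  the pair of \<open>a\<close> and the trace of \<open>M\<close> off the quartic.
\<close>

lemma slice_system_trivial:
  assumes sys: "slice_system z a p A B M N" and z: "(Re z, Im z) \<notin> spectral_locus"
  shows "(a, p, A, B, M, N) = 0"
proof -
  define m where "m = (\<Sum>k\<in>UNIV. M$k$k)"
  have m3: "m = M$1$1 + M$2$2 + M$3$3" by (simp add: m_def sum_3)
  have a: "- a - 2 * \<i> * cnj m = z * a"
    and p: "\<And>k. - p$k + 2 * \<i> * cnj (A$k) + 2 * \<i> * cnj (axial N $ k) = cnj z * p$k"
    and A: "\<And>k. \<i> * cnj (p$k) - 2 * A$k = z * A$k"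
    and B: "\<And>k. 2 * cnj (axial N $ k) = z * B$k"
    and M: "\<And>r c. 2 * cnj (M$c$r) - 2 * M$r$c - (if r = c then 2 * cnj m + \<i> * cnj a else 0) = cnj z * M$r$c"
    and N: "\<And>r c. skew (\<chi> k. \<i> * cnj (p$k) + 2 * cnj (B$k)) $ r $ c = cnj z * N$r$c"
    using sys unfolding slice_system_def m_def by blast+
  have M_diag: "2 * cnj (M$r$r) - 2 * M$r$r - (2 * cnj m + \<i> * cnj a) = cnj z * M$r$r" for r
    using M[of r r] by simp
  have M_off: "2 * cnj (M$c$r) - 2 * M$r$c = cnj z * M$r$c" if "r \<noteq> c" for r c
    using M[of c r] that by simp
  have circle: "(z + 2) * (cnj z + 2) \<noteq> 4"
    and quartic: "(z + 4) * (z - 1) * ((cnj z + 4) * (cnj z - 1)) \<noteq> 16 * ((z + 1) * (cnj z + 1))"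
    using z by (auto simp: spectral_locus_iff)
  have D: "z * (z + 3) * ((cnj z)\<^sup>2 - 8) \<noteq> 4 * cnj z * (z + 2)"
    using z vector_determinant_zero by blast
  have "z \<noteq> 0" using circle by auto
  have n: "cnj z * axial N $ k = 2 * \<i> * cnj (p$k) + 4 * cnj (B$k)" for k
  proof -
    have "skew (\<chi> k. \<i> * cnj (p$k) + 2 * cnj (B$k)) = (\<chi> r c. cnj z * N$r$c)"
      unfolding vec_eq_iff vec_lambda_beta using N by blast
    then have "axial (skew (\<chi> k. \<i> * cnj (p$k) + 2 * cnj (B$k))) $ k = axial (\<chi> r c. cnj z * N$r$c) $ k"
      by (simp only:)
    also have "axial (\<chi> r c. cnj z * N$r$c) $ k = cnj z * axial N $ k"
      using exhaust_3[of k] by (elim disjE) (simp_all add: axial_def right_diff_distrib)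
    finally show ?thesis
      unfolding axial_skew vec_lambda_beta by algebra
  qed
  have vec: "p$k = 0 \<and> A$k = 0 \<and> B$k = 0 \<and> axial N $ k = 0" for k
  proof -
    have "- cnj (p$k) + 2 * (- \<i>) * A$k + 2 * (- \<i>) * axial N $ k = z * cnj (p$k)"
      using arg_cong[OF p[of k], of cnj] by (simp only: complex_cnj_add complex_cnj_minus
          complex_cnj_mult complex_cnj_i complex_cnj_numeral complex_cnj_cnj)
    then have 1: "(z + 1) * cnj (p$k) = - 2 * \<i> * (A$k + axial N $ k)" by algebra
    have 2: "(z + 2) * A$k = \<i> * cnj (p$k)" using A[of k] by algebra
    have 3: "cnj z * cnj (B$k) = 2 * axial N $ k" using arg_cong[OF B[of k], of cnj] by simp
    show ?thesis
      using vector_block_trivial[OF 1 2 3 n D] by simp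
  qed
  then have "N$r$c = 0" for r c
  proof -
    have "skew (\<chi> k. 0) $ r $ c = cnj z * N$r$c"
      using N[of r c] vec by simp
    with \<open>z \<noteq> 0\<close> show ?thesis by (simp add: skew_zero)
  qed
  moreover have off: "M$r$c = 0" if "r \<noteq> c" for r c
  proof (rule conjugate_pair_trivial[OF _ _ circle])
    show "(cnj z + 2) * M$r$c = 2 * cnj (M$c$r)"
      using M_off[OF that] by algebra
    show "(cnj z + 2) * M$c$r = 2 * cnj (M$r$c)"
      using M_off[OF that[symmetric]] by algebra
  qed
  moreover have diff: "M$r$r - M$c$c = 0" for r c
  proof (rule conjugate_pair_trivial[OF _ _ circle])
    show "(cnj z + 2) * (M$r$r - M$c$c) = 2 * cnj (M$r$r - M$c$c)"
      using M_diag[of r] M_diag[of c] unfolding complex_cnj_diff by algebra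
    from this show "(cnj z + 2) * (M$r$r - M$c$c) = 2 * cnj (M$r$r - M$c$c)" .
  qed
  have m: "(cnj z + 2) * m + 4 * cnj m = - 3 * \<i> * cnj a"
    using M_diag[of 1] M_diag[of 2] M_diag[of 3] unfolding m3 complex_cnj_add by algebra
  have a': "(cnj z + 1) * cnj a = 2 * \<i> * m"
  proof -
    have "- cnj a - 2 * (- \<i>) * m = cnj z * cnj a"
      using arg_cong[OF a, of cnj] by (simp only: complex_cnj_diff complex_cnj_minus
          complex_cnj_mult complex_cnj_i complex_cnj_numeral complex_cnj_cnj)
    then show ?thesis by algebra
  qed
  have i: "\<i> * \<i> = -1" by simp
  have m1: "(cnj z + 4) * (cnj z - 1) * m = - 4 * (cnj z + 1) * cnj m"
    using m a' i by algebra
  have m2: "(z + 4) * (z - 1) * cnj m = - 4 * (z + 1) * m"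
    using arg_cong[OF m1, of cnj] by (simp only: complex_cnj_add complex_cnj_diff complex_cnj_neg_numeral
        complex_cnj_mult complex_cnj_numeral complex_cnj_one complex_cnj_cnj)
  have "((z + 4) * (z - 1) * ((cnj z + 4) * (cnj z - 1)) - 16 * ((z + 1) * (cnj z + 1))) * m = 0"
    using m1 m2 by algebra
  with quartic have m0: "m = 0" by simp
  then have "(cnj z + 1) * cnj a = 0" "- 3 * \<i> * cnj a = 0"
    using a' m by simp_all
  then have "a = 0" by simp
  moreover have "M$r$r = 0" for r
  proof -
    have "3 * M$r$r = m"
      using diff[of r 1] diff[of r 2] diff[of r 3] unfolding m3 by algebra
    with m0 show ?thesis by simp
  qed
  then have "M$r$c = 0" for r c
    using off by (cases "r = c") auto
  ultimately show ?thesis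
    using vec by (simp add: zero_prod_def vec_eq_iff)
qed

text \<open>
  When $|C| = |K|$, a real-linear equation $C m + K \bar m = 0$ has rank one. The solutions
  $m = K \bar w - \bar C w$ for $w = 1$ and $w = i$ cannot both be zero.
\<close>

lemma antilinear_solution:
  fixes C K :: complex
  assumes "C * cnj C = K * cnj K" "K \<noteq> 0"
  obtains m where "m \<noteq> 0" "C * m + K * cnj m = 0"
proof (cases "K = cnj C")
  case True
  have "C * (- \<i> * (K + cnj C)) + K * cnj (- \<i> * (K + cnj C)) = - \<i> * (C * cnj C - K * cnj K)"
    by (simp add: algebra_simps)
  with True assms show ?thesis by (intro that[of "- \<i> * (K + cnj C)"]) auto
next
  case False
  have "C * (K - cnj C) + K * cnj (K - cnj C) = K * cnj K - C * cnj C"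
    by (simp add: algebra_simps)
  with False assms show ?thesis by (intro that[of "K - cnj C"]) auto
qed

text \<open>
  On the circle a single pair of transposed entries of \<open>M\<close> is an eigenvector, since
  $|z + 2| = 2$ makes the two equations of the pair dependent. On the quartic a scalar matrix \<open>M\<close> together with
  \<open>a\<close> is one; eliminating \<open>a\<close> leaves an equation for \<open>antilinear_solution\<close>.
\<close>

lemma slice_system_solution:
  assumes z: "(Re z, Im z) \<in> spectral_locus"
  obtains a M where "slice_system z a 0 0 0 M 0" "(a, M) \<noteq> 0"
proof -
  have ax: "axial 0 = 0" by (simp add: axial_def vec_eq_iff forall_3)
  have sys: "slice_system z a 0 0 0 M 0" if "- a - 2 * \<i> * cnj (\<Sum>k\<in>UNIV. M$k$k) = z * a"
    "\<And>r c. 2 * cnj (M$c$r) - 2 * M$r$c -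
        (if r = c then 2 * cnj (\<Sum>k\<in>UNIV. M$k$k) + \<i> * cnj a else 0) = cnj z * M$r$c" for a M
    unfolding slice_system_def using that by (simp add: ax skew_zero)
  from z consider (circle) "(z + 2) * (cnj z + 2) = 4"
    | (quartic) "(z + 4) * (z - 1) * ((cnj z + 4) * (cnj z - 1)) = 16 * ((z + 1) * (cnj z + 1))"
    by (auto simp: spectral_locus_iff)
  then show ?thesis
  proof cases
    case circle
    define M :: "complex^3^3" where
      "M = (\<chi> r c. if r = 1 \<and> c = 2 then 2 else if r = 2 \<and> c = 1 then z + 2 else 0)"
    have tr: "(\<Sum>k\<in>UNIV. M$k$k) = 0" by (simp add: M_def sum_3)
    have "slice_system z 0 0 0 0 M 0"
    proof (rule sys)
      fix r c
      show "2 * cnj (M$c$r) - 2 * M$r$c -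
        (if r = c then 2 * cnj (\<Sum>k\<in>UNIV. M$k$k) + \<i> * cnj 0 else 0) = cnj z * M$r$c"
        unfolding tr using exhaust_3[of r] exhaust_3[of c] circle
        by (auto simp: M_def algebra_simps)
    qed (simp add: tr)
    moreover have "M$1$2 = 2" by (simp add: M_def)
    then have "M \<noteq> 0" by auto
    ultimately show ?thesis by (intro that) (auto simp: zero_prod_def)
  next
    case quartic
    define C K where "C = (cnj z + 4) * (cnj z - 1)" and "K = 4 * (cnj z + 1)"
    have "z \<noteq> - 1" using quartic by auto
    then have K0: "z + 1 \<noteq> 0" "cnj z + 1 \<noteq> 0"
      by (simp add: add_eq_0_iff2, metis complex_cnj_cancel_iff complex_cnj_minus complex_cnj_one eq_neg_iff_add_eq_0)
    have "C * cnj C = K * cnj K"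
      using quartic by (simp add: C_def K_def algebra_simps)
    moreover have "K \<noteq> 0" unfolding K_def mult_eq_0_iff using K0(2) by simp
    ultimately obtain m where m: "m \<noteq> 0" "C * m + K * cnj m = 0"
      by (rule antilinear_solution)
    define a where "a = - 6 * \<i> * cnj m / (z + 1)"
    define M :: "complex^3^3" where "M = mat m"
    have tr: "(\<Sum>k\<in>UNIV. M$k$k) = 3 * m" by (simp add: M_def mat_def)
    have a: "(z + 1) * a = - 6 * \<i> * cnj m" using K0 by (simp add: a_def)
    then have a': "(cnj z + 1) * cnj a = 6 * \<i> * m"
    proof -
      have "(cnj z + 1) * cnj a = - 6 * (- \<i>) * m"
        using arg_cong[OF a, of cnj] by (simp only: complex_cnj_add complex_cnj_minus complex_cnj_neg_numeral
            complex_cnj_mult complex_cnj_i complex_cnj_numeral complex_cnj_one complex_cnj_cnj)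
      then show ?thesis by algebra
    qed
    have i: "\<i> * \<i> = -1" by simp
    have "(cnj z + 1) * (- 4 * cnj m - 2 * m - \<i> * cnj a - cnj z * m) = 0"
      using a' i m(2) unfolding C_def K_def by algebra
    then have diag: "- 4 * cnj m - 2 * m - \<i> * cnj a = cnj z * m"
      using K0 by simp
    have "slice_system z a 0 0 0 M 0"
    proof (rule sys)
      show "- a - 2 * \<i> * cnj (\<Sum>k\<in>UNIV. M$k$k) = z * a"
        unfolding tr complex_cnj_mult complex_cnj_numeral using a by algebra
      fix r c
      show "2 * cnj (M$c$r) - 2 * M$r$c -
        (if r = c then 2 * cnj (\<Sum>k\<in>UNIV. M$k$k) + \<i> * cnj a else 0) = cnj z * M$r$c"
      proof (cases "r = c")
        case True
        have "2 * cnj m - 2 * m - (2 * (3 * cnj m) + \<i> * cnj a) = cnj z * m"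
          using diag by algebra
        with True show ?thesis
          unfolding tr by (simp add: M_def mat_def)
      qed (simp add: M_def mat_def)
    qed
    moreover have "M$1$1 = m" by (simp add: M_def mat_def)
    then have "M \<noteq> 0" using m(1) by auto
    ultimately show ?thesis by (intro that) (auto simp: zero_prod_def)
  qed
qed

lemma eigenmap_slice_locus:
  "(\<exists>f. eigenmap ((z, 0), (0, 0)) f) \<longleftrightarrow> (Re z, Im z) \<in> spectral_locus"
proof
  assume "\<exists>f. eigenmap ((z, 0), (0, 0)) f"
  then show "(Re z, Im z) \<in> spectral_locus"
    unfolding eigenmap_slice_iff using slice_system_trivial by blast
next
  assume "(Re z, Im z) \<in> spectral_locus"
  then obtain a M where "slice_system z a 0 0 0 M 0" "(a, M) \<noteq> 0"
    by (rule slice_system_solution)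
  moreover from this have "(a, 0 :: complex^3, 0 :: complex^3, 0 :: complex^3, M, 0 :: complex^3^3) \<noteq> 0"
    by (auto simp: zero_prod_def)
  ultimately show "\<exists>f. eigenmap ((z, 0), (0, 0)) f"
    unfolding eigenmap_slice_iff by blast
qed

section \<open>Rotating the slice\<close>

lemma eigenmap_locus:
  assumes u: "u \<in> unit_Im_Oct"
  shows "(\<exists>f. eigenmap (oct_of_real \<mu> + Q *\<^sub>R u) f) \<longleftrightarrow> (\<mu>, Q) \<in> spectral_locus"
proof -
  let ?i = "((\<i>, 0), (0, 0)) :: octonion"
  have i: "?i \<in> unit_Im_Oct"
    by (simp add: unit_Im_Oct_def Im_Oct_def oct_Re_def norm_Pair)
  have move: "\<exists>f. eigenmap (oct_of_real \<mu> + Q *\<^sub>R w) f"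
    if f: "eigenmap (oct_of_real \<mu> + Q *\<^sub>R v) f" and v: "v \<in> unit_Im_Oct" and w: "w \<in> unit_Im_Oct" for v w f
  proof -
    obtain \<phi> where \<phi>: "\<phi> \<in> G2" "\<phi> v = w"
      using v w by (rule G2_transitive)
    have "\<phi> (oct_of_real \<mu> + Q *\<^sub>R v) = oct_of_real \<mu> + Q *\<^sub>R w"
      using \<phi> by (simp add: linear_add[OF G2D(1)] linear_cmul[OF G2D(1)] G2_of_real)
    with eigenmap_G2[OF \<phi>(1) f] show ?thesis by (intro exI) (simp only:)
  qed
  have "oct_of_real \<mu> + Q *\<^sub>R ?i = ((Complex \<mu> Q, 0), (0, 0))"
    by (simp add: oct_of_real_def complex_eq_iff)
  then have "(\<exists>f. eigenmap (oct_of_real \<mu> + Q *\<^sub>R ?i) f) \<longleftrightarrow> (\<mu>, Q) \<in> spectral_locus"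
    using eigenmap_slice_locus[of "Complex \<mu> Q"] by simp
  moreover have "(\<exists>f. eigenmap (oct_of_real \<mu> + Q *\<^sub>R u) f) \<longleftrightarrow> (\<exists>f. eigenmap (oct_of_real \<mu> + Q *\<^sub>R ?i) f)"
    by (intro iffI; elim exE) (erule move[OF _ u i], erule move[OF _ i u])
  ultimately show ?thesis by simp
qed

lemma oct_decompose:
  obtains \<mu> Q u where "x = oct_of_real \<mu> + Q *\<^sub>R u" "u \<in> unit_Im_Oct"
proof -
  have "x - oct_of_real (oct_Re x) \<in> Im_Oct"
    by (simp add: Im_Oct_def oct_Re_def oct_of_real_def)
  then obtain r u where "u \<in> unit_Im_Oct" "x - oct_of_real (oct_Re x) = r *\<^sub>R u"
    by (rule Im_Oct_decompose)
  then show ?thesis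
    using that[of "oct_Re x" r u] by (simp add: algebra_simps)
qed

lemma oct_decompose_unique:
  assumes "oct_of_real \<mu> + Q *\<^sub>R u = oct_of_real \<mu>' + Q' *\<^sub>R u" "u \<in> unit_Im_Oct"
  shows "\<mu> = \<mu>' \<and> Q = Q'"
proof -
  have "oct_Re (oct_of_real r + q *\<^sub>R u) = r" for r q
    using assms(2) by (simp add: unit_Im_Oct_def Im_Oct_def oct_Re_def oct_of_real_def)
  then have "\<mu> = \<mu>'" using assms(1) by metis
  moreover have "u \<noteq> 0" using assms(2) by (auto simp: unit_Im_Oct_def)
  ultimately show ?thesis using assms(1) by simp
qed

lemma oct_range_of_real_iff:
  assumes "u \<in> unit_Im_Oct"
  shows "oct_of_real \<mu> + Q *\<^sub>R u \<in> range oct_of_real \<longleftrightarrow> Q = 0"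
proof
  assume "oct_of_real \<mu> + Q *\<^sub>R u \<in> range oct_of_real"
  then obtain r where "oct_of_real \<mu> + Q *\<^sub>R u = oct_of_real r + 0 *\<^sub>R u" by auto
  then show "Q = 0" using oct_decompose_unique[OF _ assms] by blast
qed simp

lemma G2_orbit_unit: "u \<in> unit_Im_Oct \<Longrightarrow> G2_orbit u = unit_Im_Oct"
  unfolding G2_orbit_def using G2_unit_Im_Oct G2_transitive[of u] by blast

theorem corollary7p3:
  fixes hat :: "'v::euclidean_space \<Rightarrow> octonion" and e :: "7 \<Rightarrow> 'v"
  assumes "DIM('v) = 7"
    and "isometric_identification hat"
    and "orthonormal_basis e"
  shows "right_spectrum (h_op hat e) =
           {oct_of_real \<mu> + Q *\<^sub>R u |\<mu> Q u. u \<in> unit_Im_Oct \<and> (\<mu>, Q) \<in> spectral_locus} \<and>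
         (\<forall>u \<in> unit_Im_Oct.
           right_spectrum (h_op hat e) \<inter> slice u =
             {oct_of_real \<mu> + Q *\<^sub>R u |\<mu> Q. (\<mu>, Q) \<in> spectral_locus} \<and>
           right_spectrum (h_op hat e) =
             {\<phi> x |\<phi> x. \<phi> \<in> G2 \<and> x \<in> right_spectrum (h_op hat e) \<inter> slice u} \<and>
           right_spectrum (h_op hat e) - range oct_of_real =
             {oct_of_real \<mu> + Q *\<^sub>R v |\<mu> Q v.
                v \<in> G2_orbit u \<and> (\<mu>, Q) \<in> spectral_locus \<and> Q \<noteq> 0})"
proof -
  define S where "S = right_spectrum (h_op hat e)"
  have S_iff: "oct_of_real \<mu> + Q *\<^sub>R u \<in> S \<longleftrightarrow> (\<mu>, Q) \<in> spectral_locus" if "u \<in> unit_Im_Oct" for \<mu> Q u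
    using eigenmap_locus[OF that] by (simp add: S_def right_spectrum_eq_eigenmap[OF assms(2,3)])
  have S: "S = {oct_of_real \<mu> + Q *\<^sub>R u |\<mu> Q u. u \<in> unit_Im_Oct \<and> (\<mu>, Q) \<in> spectral_locus}" (is "S = ?R")
  proof (intro set_eqI iffI)
    fix x assume "x \<in> S"
    moreover obtain \<mu> Q u where "x = oct_of_real \<mu> + Q *\<^sub>R u" "u \<in> unit_Im_Oct"
      by (rule oct_decompose)
    ultimately show "x \<in> ?R" using S_iff by blast
  next
    fix x assume "x \<in> ?R"
    then show "x \<in> S" using S_iff by blast
  qed
  have "S \<inter> slice u = {oct_of_real \<mu> + Q *\<^sub>R u |\<mu> Q. (\<mu>, Q) \<in> spectral_locus} \<and>
      S = {\<phi> x |\<phi> x. \<phi> \<in> G2 \<and> x \<in> S \<inter> slice u} \<and>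
      S - range oct_of_real =
        {oct_of_real \<mu> + Q *\<^sub>R v |\<mu> Q v. v \<in> G2_orbit u \<and> (\<mu>, Q) \<in> spectral_locus \<and> Q \<noteq> 0}"
    if u: "u \<in> unit_Im_Oct" for u
  proof (intro conjI)
    show slice: "S \<inter> slice u = {oct_of_real \<mu> + Q *\<^sub>R u |\<mu> Q. (\<mu>, Q) \<in> spectral_locus}"
      unfolding slice_def using S_iff[OF u] by blast
    have image: "\<phi> (oct_of_real \<mu> + Q *\<^sub>R u) = oct_of_real \<mu> + Q *\<^sub>R \<phi> u" if "\<phi> \<in> G2" for \<phi> \<mu> Q
      using that by (simp add: linear_add[OF G2D(1)] linear_cmul[OF G2D(1)] G2_of_real)
    show "S = {\<phi> x |\<phi> x. \<phi> \<in> G2 \<and> x \<in> S \<inter> slice u}" (is "S = ?R")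
    proof (intro set_eqI iffI)
      fix x assume "x \<in> S"
      then obtain \<mu> Q v where x: "x = oct_of_real \<mu> + Q *\<^sub>R v" "v \<in> unit_Im_Oct" "(\<mu>, Q) \<in> spectral_locus"
        unfolding S by blast
      obtain \<phi> where \<phi>: "\<phi> \<in> G2" "\<phi> u = v"
        using u x(2) by (rule G2_transitive)
      have "x = \<phi> (oct_of_real \<mu> + Q *\<^sub>R u)"
        by (simp add: x(1) \<phi>(2) image[OF \<phi>(1)])
      with \<phi>(1) x(3) show "x \<in> ?R"
        unfolding slice by blast
    next
      fix x assume "x \<in> ?R"
      then obtain \<phi> \<mu> Q where \<phi>: "\<phi> \<in> G2" "x = \<phi> (oct_of_real \<mu> + Q *\<^sub>R u)" "(\<mu>, Q) \<in> spectral_locus"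
        unfolding slice by blast
      then show "x \<in> S"
        using S_iff[OF G2_unit_Im_Oct[OF \<phi>(1) u]] image by simp
    qed
    show "S - range oct_of_real =
        {oct_of_real \<mu> + Q *\<^sub>R v |\<mu> Q v. v \<in> G2_orbit u \<and> (\<mu>, Q) \<in> spectral_locus \<and> Q \<noteq> 0}" (is "_ = ?N")
    proof (intro set_eqI iffI)
      fix x assume "x \<in> S - range oct_of_real"
      then obtain \<mu> Q v where x: "x = oct_of_real \<mu> + Q *\<^sub>R v" "v \<in> unit_Im_Oct" "(\<mu>, Q) \<in> spectral_locus"
        and "x \<notin> range oct_of_real"
        unfolding S by blast
      then have "Q \<noteq> 0"
        using oct_range_of_real_iff by blast
      with x show "x \<in> ?N"
        unfolding G2_orbit_unit[OF u] by blast
    next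
      fix x assume "x \<in> ?N"
      then obtain \<mu> Q v where x: "x = oct_of_real \<mu> + Q *\<^sub>R v" "v \<in> unit_Im_Oct" "(\<mu>, Q) \<in> spectral_locus"
        and "Q \<noteq> 0"
        unfolding G2_orbit_unit[OF u] by blast
      then show "x \<in> S - range oct_of_real"
        using S_iff[OF x(2)] oct_range_of_real_iff[OF x(2)] by simp
    qed
  qed
  note slices = this
  show ?thesis
    unfolding S_def[symmetric] by (rule conjI[OF S], rule ballI, rule slices)
qed

end
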